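(* Let $k\ge1$ and $d\ge1$ be integers and let $0<\theta<1$ be real with $d\theta>1$. Let $\Phi:\omega^{\not\downarrow k}\to\omega^{\not\downarrow k+1}$ be defined by $\Phi(v)=(0)^{\frown}v$ (the sequence obtained by putting $0$ in front of $v$), and extend $\Phi$ to finitely supported vectors by $\Phi\left(\sum_i a_ie_{v_i}\right)=\sum_i a_ie_{\Phi(v_i)}$. Then $\Phi$ extends to a linear isometric embedding $\Phi:T_k(d,\theta)\to T_{k+1}(d,\theta)$, i.e. an isometric isomorphism onto its range.
   Context: Sequences and orders. $\omega=\{0,1,2,\dots\}$. For an integer $k\ge1$, $\omega^{\not\downarrow\le k}$ is the set of all non-decreasing finite sequences of elements of $\omega$ of length at most $k$ (including the empty sequence $()$), and $\omega^{\not\downarrow k}$ is the set of those of length exactly $k$. Write $s\sqsubset t$ if $s$ is a proper initial segment of $t$. Let $<_{\mathrm{lex}}$ be the lexicographic order in which a proper initial segment precedes the longer sequence. The well-order $\prec$ (of order type $\omega$) on $\omega^{\not\downarrow\le k}$ is: $()\prec s$ for all nonempty $s$; and for nonempty sequences, $(s_1,\dots,s_i)\prec(t_1,\dots,t_j)$ iff $s_i<t_j$, or $s_i=t_j$ and $(s_1,\dots,s_i)<_{\mathrm{lex}}(t_1,\dots,t_j)$. The spaces $\mathcal E_k$. An $\mathcal E_k$-tree is a function $\widehat X:\omega^{\not\downarrow\le k}\to\omega^{\not\downarrow\le k}$ preserving $\prec$ and $\sqsubset$ (hence preserving lengths). $\mathcal E_k$ is the collection of all sets $X=\widehat X[\omega^{\not\downarrow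 k}]$, for $\widehat X$ an $\mathcal E_k$-tree. For $X\in\mathcal E_k$ and $n\ge1$, $r_n(X)$ is the set of the $\prec$-least $n$ elements of $X$, and $\mathcal{AR}^k=\{r_n(X):X\in\mathcal E_k,\ n\ge1\}$. (For $k=1$, $\mathcal{AR}^1$ is the set of all nonempty finite subsets of $\omega$.) The Banach space $T_k(d,\theta)$. For nonempty finite $E,F\subset\omega^{\not\downarrow k}$, $E<F$ means $\max_\prec E\prec\min_\prec F$. Let $c_{00}(\omega^{\not\downarrow k})$ be the space of finitely supported functions $x:\omega^{\not\downarrow k}\to\mathbb R$, with canonical basis $(e_v)$, and $Ex=\sum_{v\in E}x_ve_v$. A sequence $(E_i)_{i=1}^m$ in $\mathcal{AR}^k$ is $d$-admissible if $m\le d$ and $E_1<\cdots<E_m$. Put $|x|_0=\max_v|x_v|$ and $|x|_{j+1}=\max\{|x|_j,\ \theta\max\{\sum_{i=1}^m|E_ix|_j:1\le m\le d,\ (E_i)_{i=1}^m\ d\text{-admissible}\}\}$, and $\|x\|=\sup_j|x|_j$. $T_k(d,\theta)$ is the completion of $c_{00}(\omega^{\not\downarrow k})$ in this norm. *)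

theory Defs
  imports Complex_Main "HOL-Library.Sublist" "HOL-Library.FuncSet"
begin

section \<open>Sequences, orders and the spaces \<open>\<E>\<^sub>k\<close>\<close>

definition nondec_le :: "nat \<Rightarrow> nat list set" where
  "nondec_le k = {s. sorted s \<and> length s \<le> k}"

definition nondec :: "nat \<Rightarrow> nat list set" where
  "nondec k = {s. sorted s \<and> length s = k}"

text \<open>\<open>lexord less_than\<close> is the lexicographic order in which a proper initial segment precedes
  the longer sequence.\<close>

definition prec :: "nat list \<Rightarrow> nat list \<Rightarrow> bool"  (infix \<open>\<prec>\<close> 50) where
  "s \<prec> t \<longleftrightarrow> t \<noteq> [] \<and>
     (s = [] \<or> last s < last t \<or> (last s = last t \<and> (s, t) \<in> lexord less_than))"

definition E_tree :: "nat \<Rightarrow> (nat list \<Rightarrow> nat list) \<Rightarrow> bool" where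
  "E_tree k f \<longleftrightarrow> f \<in> nondec_le k \<rightarrow> nondec_le k \<and>
     (\<forall>s\<in>nondec_le k. \<forall>t\<in>nondec_le k. s \<prec> t \<longrightarrow> f s \<prec> f t) \<and>
     (\<forall>s\<in>nondec_le k. \<forall>t\<in>nondec_le k. strict_prefix s t \<longrightarrow> strict_prefix (f s) (f t))"

definition E_space :: "nat \<Rightarrow> nat list set set" where
  "E_space k = {f ` nondec k | f. E_tree k f}"

text \<open>The \<open>n\<close> least elements of \<open>X\<close>. For \<open>X \<subseteq> nondec k\<close> the sets whose cardinality is taken are
  finite, because \<open>\<prec>\<close> has order type \<open>\<omega>\<close> there.\<close>

definition least_elems :: "nat \<Rightarrow> nat list set \<Rightarrow> nat list set" where
  "least_elems n X = {x \<in> X. card {y \<in> X. y \<prec> x} < n}"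

definition AR :: "nat \<Rightarrow> nat list set set" where
  "AR k = {least_elems n X | n X. X \<in> E_space k \<and> 1 \<le> n}"

text \<open>For nonempty finite sets this says that the \<open>\<prec>\<close>-maximum of \<open>E\<close> precedes the
  \<open>\<prec>\<close>-minimum of \<open>F\<close>; all elements of \<open>AR k\<close> are nonempty and finite.\<close>

definition block_less :: "nat list set \<Rightarrow> nat list set \<Rightarrow> bool" where
  "block_less E F \<longleftrightarrow> (\<forall>u\<in>E. \<forall>v\<in>F. u \<prec> v)"

text \<open>\<open>Es = [E\<^sub>1, \<dots>, E\<^sub>m]\<close> with \<open>1 \<le> m \<le> d\<close> and \<open>E\<^sub>1 < \<dots> < E\<^sub>m\<close>.\<close>

definition admissible :: "nat \<Rightarrow> nat \<Rightarrow> nat list set list \<Rightarrow> bool" where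
  "admissible k d Es \<longleftrightarrow> 1 \<le> length Es \<and> length Es \<le> d \<and> set Es \<subseteq> AR k \<and> sorted_wrt block_less Es"

section \<open>The norm on finitely supported vectors\<close>

type_synonym vec = "nat list \<Rightarrow> real"

definition unit_vec :: "nat list \<Rightarrow> vec" where
  "unit_vec v = (\<lambda>w. if w = v then 1 else 0)"

definition restr :: "nat list set \<Rightarrow> vec \<Rightarrow> vec" where
  "restr E x = (\<lambda>v. if v \<in> E then x v else 0)"

text \<open>The suprema below are maxima for finitely supported \<open>x\<close>, since then only finitely many values
  occur (\<open>restr E x\<close> depends only on the intersection of \<open>E\<close> with the support of \<open>x\<close>).\<close>

primrec T_norm_approx :: "nat \<Rightarrow> nat \<Rightarrow> real \<Rightarrow> nat \<Rightarrow> vec \<Rightarrow> real" where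
  "T_norm_approx k d \<theta> 0 x = (SUP v\<in>nondec k. \<bar>x v\<bar>)"
| "T_norm_approx k d \<theta> (Suc j) x =
     max (T_norm_approx k d \<theta> j x)
         (\<theta> * (SUP Es\<in>{Es. admissible k d Es}. \<Sum>E\<leftarrow>Es. T_norm_approx k d \<theta> j (restr E x)))"

definition T_norm :: "nat \<Rightarrow> nat \<Rightarrow> real \<Rightarrow> vec \<Rightarrow> real" where
  "T_norm k d \<theta> x = (SUP j. T_norm_approx k d \<theta> j x)"

section \<open>Real normed spaces with explicit carriers, and their completions\<close>

text \<open>The spaces depend on the numbers \<open>k\<close>, \<open>d\<close> and \<open>\<theta>\<close>, so they cannot be instances of the
  type class of normed spaces; they are given by their carrier and operations.\<close>

record 'a nspace =
  pts :: "'a set"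
  add :: "'a \<Rightarrow> 'a \<Rightarrow> 'a"
  scale :: "real \<Rightarrow> 'a \<Rightarrow> 'a"
  nrm :: "'a \<Rightarrow> real"

definition ndist :: "'a nspace \<Rightarrow> 'a \<Rightarrow> 'a \<Rightarrow> real" where
  "ndist V x y = nrm V (add V x (scale V (- 1) y))"

definition cauchy_seqs :: "'a nspace \<Rightarrow> (nat \<Rightarrow> 'a) set" where
  "cauchy_seqs V = {X. (\<forall>n. X n \<in> pts V) \<and>
     (\<forall>e>0. \<exists>N. \<forall>m\<ge>N. \<forall>n\<ge>N. ndist V (X m) (X n) < e)}"

definition cauchy_equiv :: "'a nspace \<Rightarrow> ((nat \<Rightarrow> 'a) \<times> (nat \<Rightarrow> 'a)) set" where
  "cauchy_equiv V = {(X, Y). X \<in> cauchy_seqs V \<and> Y \<in> cauchy_seqs V \<and>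
     (\<lambda>n. ndist V (X n) (Y n)) \<longlonglongrightarrow> 0}"

text \<open>Cauchy sequences modulo sequences tending to \<open>0\<close>. The operations on classes do not depend on
  the representatives, so the unions below are again single classes, and the norm of a class is the
  common limit of the norms along its representatives.\<close>

definition completion :: "'a nspace \<Rightarrow> (nat \<Rightarrow> 'a) set nspace" where
  "completion V = \<lparr>
     pts = cauchy_seqs V // cauchy_equiv V,
     add = (\<lambda>A B. \<Union>X\<in>A. \<Union>Y\<in>B. cauchy_equiv V `` {\<lambda>n. add V (X n) (Y n)}),
     scale = (\<lambda>c A. \<Union>X\<in>A. cauchy_equiv V `` {\<lambda>n. scale V c (X n)}),
     nrm = (\<lambda>A. THE r. \<forall>X\<in>A. (\<lambda>n. nrm V (X n)) \<longlonglongrightarrow> r) \<rparr>"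

definition to_completion :: "'a nspace \<Rightarrow> 'a \<Rightarrow> (nat \<Rightarrow> 'a) set" where
  "to_completion V x = cauchy_equiv V `` {\<lambda>n. x}"

definition linear_isometric_embedding :: "'a nspace \<Rightarrow> 'b nspace \<Rightarrow> ('a \<Rightarrow> 'b) \<Rightarrow> bool" where
  "linear_isometric_embedding V W F \<longleftrightarrow> F \<in> pts V \<rightarrow> pts W \<and> inj_on F (pts V) \<and>
     (\<forall>u\<in>pts V. \<forall>v\<in>pts V. F (add V u v) = add W (F u) (F v)) \<and>
     (\<forall>c. \<forall>u\<in>pts V. F (scale V c u) = scale W c (F u)) \<and>
     (\<forall>u\<in>pts V. nrm W (F u) = nrm V u)"

section \<open>The spaces \<open>T\<^sub>k(d, \<theta>)\<close> and the map \<open>\<Phi>\<close>\<close>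

definition c00 :: "nat \<Rightarrow> nat \<Rightarrow> real \<Rightarrow> vec nspace" where
  "c00 k d \<theta> = \<lparr>
     pts = {x. finite {v. x v \<noteq> 0} \<and> {v. x v \<noteq> 0} \<subseteq> nondec k},
     add = (\<lambda>x y v. x v + y v),
     scale = (\<lambda>c x v. c * x v),
     nrm = T_norm k d \<theta> \<rparr>"

definition T_space :: "nat \<Rightarrow> nat \<Rightarrow> real \<Rightarrow> (nat \<Rightarrow> vec) set nspace" where
  "T_space k d \<theta> = completion (c00 k d \<theta>)"

definition Phi :: "nat list \<Rightarrow> nat list" where
  "Phi v = 0 # v"

definition Phi_vec :: "vec \<Rightarrow> vec" where
  "Phi_vec x = (\<lambda>w. \<Sum>v | x v \<noteq> 0. x v * unit_vec (Phi v) w)"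

end

theory Submission imports Defs
begin

text \<open>It suffices that \<open>\<Phi>\<close> preserves each \<open>|\<cdot>|\<^sub>j\<close>, which follows by induction on \<open>j\<close> once
  admissible families can be moved in both directions. The preimage under \<open>\<Phi>\<close> of a set in
  \<open>AR (k + 1)\<close> is empty or in \<open>AR k\<close>, because a tree either fixes \<open>(0)\<close>, and then restricts to a
  tree one level down, or misses the range of \<open>\<Phi>\<close> altogether. Conversely \<open>\<Phi>[E]\<close> itself is usually not
  in \<open>AR (k + 1)\<close>, but it can be enlarged by points outside the range of \<open>\<Phi>\<close> to a set in \<open>AR (k + 1)\<close>
  with the same \<open>\<prec>\<close>-minimum and \<open>\<prec>\<close>-maximum, so the order between blocks is kept.\<close>

section \<open>The order\<close>

text \<open>Points outside the range of \<Phi> are unavoidable because \<prec> compares last entries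
  before anything else: for \<open>k = 1\<close> the order one level up begins (0,0), (0,1), (1,1),
  (0,2). A tree sends (1,1) to a sequence with positive head, so an initial segment of its image
  with three or more points never has the form \<Phi>[E]. Both transfers rest on rigidity: a tree
  keeps lengths, and the head of a value depends only on the head of the argument, strictly
  increasingly. The obstacle is to define the larger tree away from (0) without disturbing the
  prescribed values \<Phi>(f u): the new last entries have to fit in between. There is room because
  last entries of \<open>f\<close> on sequences ending in b lie strictly below those on sequences
  ending in b + 1; monotonicity alone gives only a weak inequality, and
  \<open>E_tree_last_less\<close> excludes equality.\<close>

lemma prec_irrefl: "\<not> s \<prec> s"
  by (auto simp: prec_def lexord_irreflexive)

lemma lexord_less_than_trans:
  "(s, t) \<in> lexord less_than \<Longrightarrow> (t, u) \<in> lexord less_than \<Longrightarrow> (s, u) \<in> lexord less_than"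
  by (rule lexord_trans) (auto intro: transI)

lemma prec_trans: "s \<prec> t \<Longrightarrow> t \<prec> u \<Longrightarrow> s \<prec> u"
  unfolding prec_def by (auto intro: lexord_less_than_trans)

lemma lexord_less_than_total:
  "s \<noteq> t \<Longrightarrow> (s, t) \<in> lexord less_than \<or> (t, s) \<in> lexord (less_than :: (nat \<times> nat) set)"
  using lexord_linear[of less_than s t] by (metis less_than_iff nat_neq_iff)

lemma prec_total: "s \<noteq> t \<Longrightarrow> s \<prec> t \<or> t \<prec> s"
  using lexord_less_than_total[of s t] unfolding prec_def by (auto simp: less_than_iff)

abbreviation prec_eq :: "nat list \<Rightarrow> nat list \<Rightarrow> bool"  (infix \<open>\<preceq>\<close> 50) where
  "s \<preceq> t \<equiv> s \<prec> t \<or> s = t"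

lemma prec_imp_last_le: "s \<prec> t \<Longrightarrow> s \<noteq> [] \<Longrightarrow> last s \<le> last t"
  by (auto simp: prec_def)

lemma Phi_prec_iff: "Phi s \<prec> Phi t \<longleftrightarrow> s \<prec> t"
  by (cases s; cases t) (auto simp: prec_def Phi_def)

lemma inj_Phi: "inj Phi"
  by (auto simp: inj_def Phi_def)

lemma Phi_mem_nondec_iff: "Phi v \<in> nondec (k + 1) \<longleftrightarrow> v \<in> nondec k"
  by (auto simp: nondec_def Phi_def)

lemma Phi_mem_nondec_le_iff: "Phi v \<in> nondec_le (k + 1) \<longleftrightarrow> v \<in> nondec_le k"
  by (auto simp: nondec_le_def Phi_def)

lemma nondec_subset_nondec_le: "nondec k \<subseteq> nondec_le k"
  by (auto simp: nondec_def nondec_le_def)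

lemma replicate_mem_nondec: "replicate k b \<in> nondec k"
  by (simp add: nondec_def)

lemma le_last_sorted: "sorted s \<Longrightarrow> a \<in> set s \<Longrightarrow> a \<le> last s"
  by (induction s) (auto split: if_splits)

text \<open>Sortedness bounds all entries of a predecessor by its last entry, which is at most
  \<open>last x\<close>. This is the part of "order type \<omega>" that the proof uses.\<close>

lemma finite_prec_nondec: "finite {y \<in> nondec k. y \<prec> x}"
proof (rule finite_subset)
  show "{y \<in> nondec k. y \<prec> x} \<subseteq> {xs. set xs \<subseteq> {..last x} \<and> length xs = k}"
  proof safe
    fix y a assume "y \<in> nondec k" "y \<prec> x" "a \<in> set y"
    then show "a \<le> last x"
      using le_last_sorted[of y a] prec_imp_last_le[of y x]
      by (cases "y = []") (auto simp: nondec_def)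
  qed (simp add: nondec_def)
qed (rule finite_lists_length_eq, simp)

text \<open>Equal last entries leave the lexicographic comparison, and no entry of \<open>s\<close>
  exceeds its last one. The constant sequence is the top of the band of sequences with a given last
  entry.\<close>

lemma prec_eq_replicate_last:
  assumes "s \<in> nondec_le k" "s \<noteq> []"
  shows "s \<preceq> replicate k (last s)"
proof -
  \<comment> \<open>The bound \<open>b\<close> is detached from \<open>last s\<close>, so that the
    induction can remove heads while keeping the bound.\<close>
  have "s = replicate k b \<or> (s, replicate k b) \<in> lexord less_than"
    if "length s \<le> k" "\<forall>a\<in>set s. a \<le> b" for s k and b :: nat
    using that
  proof (induction s arbitrary: k)
    case Nil
    then show ?case by (cases k) auto
  next
    case (Cons a s)
    then obtain m where "k = Suc m" by (cases k) auto
    with Cons show ?case by (auto simp: less_than_iff)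
  qed
  from this[of s k "last s"] assms show ?thesis
    using le_last_sorted[of s] by (cases k) (auto simp: prec_def nondec_le_def)
qed

text \<open>The bottom of the band. Positivity matters: a padding 0 precedes any positive entry, but
  with last entry 0 the shorter (0) would precede the padded sequence.\<close>

lemma zeros_snoc_prec_eq:
  assumes "s \<in> nondec_le (Suc m)" "s \<noteq> []" "0 < last s"
  shows "replicate m 0 @ [last s] \<preceq> s"
proof -
  have "replicate m 0 @ [last s] = s \<or> (replicate m 0 @ [last s], s) \<in> lexord less_than"
    if "length s \<le> Suc m" "s \<noteq> []" "0 < last s" for s :: "nat list" and m
    using that
  proof (induction m arbitrary: s)
    case 0
    then show ?case by (cases s) auto
  next
    case (Suc m)
    then show ?case by (cases s) (auto simp: less_than_iff split: if_splits)
  qed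
  from this[of s m] assms show ?thesis
    by (auto simp: prec_def nondec_le_def)
qed

lemma zeros_prec_eq:
  assumes "s \<in> nondec k" shows "replicate k 0 \<preceq> s"
proof -
  have "replicate (length s) 0 = s \<or> (replicate (length s) 0, s) \<in> lexord less_than"
    for s :: "nat list"
    by (induction s) (auto simp: less_than_iff)
  from this[of s] assms show ?thesis
    by (cases k) (auto simp: prec_def nondec_def simp flip: replicate_Suc)
qed

section \<open>Trees\<close>

lemma E_treeD:
  assumes "E_tree k f"
  shows "s \<in> nondec_le k \<Longrightarrow> f s \<in> nondec_le k"
    and "s \<in> nondec_le k \<Longrightarrow> t \<in> nondec_le k \<Longrightarrow> s \<prec> t \<Longrightarrow> f s \<prec> f t"
    and "s \<in> nondec_le k \<Longrightarrow> t \<in> nondec_le k \<Longrightarrow> strict_prefix s t \<Longrightarrow> strict_prefix (f s) (f t)"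
  using assms by (auto simp: E_tree_def)

lemma E_tree_prec_eq:
  "E_tree k f \<Longrightarrow> s \<in> nondec_le k \<Longrightarrow> t \<in> nondec_le k \<Longrightarrow> s \<preceq> t \<Longrightarrow> f s \<preceq> f t"
  using E_treeD(2) by blast

lemma E_tree_length_append:
  assumes "E_tree k f" "s @ u \<in> nondec_le k"
  shows "length (f s) + length u \<le> length (f (s @ u))"
  using assms(2)
proof (induction u rule: rev_induct)
  case (snoc a u)
  then have su: "s @ u \<in> nondec_le k"
    by (auto simp: nondec_le_def sorted_append)
  have "strict_prefix (f (s @ u)) (f (s @ u @ [a]))"
    using su snoc.prems by (intro E_treeD(3)[OF assms(1)]) (auto simp: strict_prefix_def prefix_def)
  then have "length (f (s @ u)) < length (f (s @ u @ [a]))"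
    by (rule prefix_length_less)
  with snoc.IH[OF su] show ?case by simp
qed simp

text \<open>Strict prefixes make lengths grow by at least one per entry, both from \<open>[]\<close>
  to \<open>s\<close> and from \<open>s\<close> to an extension of length \<open>k\<close>. No value
  is longer than \<open>k\<close>, so neither stretch has slack.\<close>

lemma E_tree_length:
  assumes f: "E_tree k f" and s: "s \<in> nondec_le k"
  shows "length (f s) = length s"
proof -
  \<comment> \<open>\<open>sum_list s\<close> bounds every entry, also for empty \<open>s\<close>,
    so the padded sequence stays sorted.\<close>
  let ?u = "replicate (k - length s) (sum_list s)"
  have su: "s @ ?u \<in> nondec_le k"
    using s by (auto simp: nondec_le_def sorted_append intro: member_le_sum_list)
  have "length (f s) + (k - length s) \<le> k"
    using E_tree_length_append[OF f su] E_treeD(1)[OF f su] by (simp add: nondec_le_def)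
  moreover have "length s \<le> k"
    using s by (simp add: nondec_le_def)
  moreover have "length s \<le> length (f s)"
    using E_tree_length_append[OF f, of "[]" s] s by simp
  ultimately show ?thesis by simp
qed

lemma E_tree_image_nondec:
  assumes "E_tree k f" shows "f ` nondec k \<subseteq> nondec k"
proof safe
  fix s assume s: "s \<in> nondec k"
  then have "s \<in> nondec_le k" using nondec_subset_nondec_le by blast
  then show "f s \<in> nondec k"
    using E_tree_length[OF assms] E_treeD(1)[OF assms] s by (simp add: nondec_def nondec_le_def)
qed

lemma E_tree_singleton:
  assumes "E_tree k f" "1 \<le> k"
  shows "f [a] = [hd (f [a])]"
  using E_tree_length[OF assms(1), of "[a]"] assms(2)
  by (auto simp: nondec_le_def length_Suc_conv)

text \<open>By the prefix condition \<open>f s\<close> extends or equals \<open>f [hd s]\<close>,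
  which has length one.\<close>

lemma E_tree_hd:
  assumes f: "E_tree k f" and s: "s \<in> nondec_le k" "s \<noteq> []"
  shows "hd (f s) = hd (f [hd s])"
proof -
  have k: "1 \<le> k" using s by (cases s) (auto simp: nondec_le_def)
  show ?thesis
  proof (cases "s = [hd s]")
    case False
    with s(2) have "strict_prefix [hd s] s" by (cases s) (auto simp: strict_prefix_def)
    then have "strict_prefix (f [hd s]) (f s)"
      using s k by (intro E_treeD(3)[OF f]) (auto simp: nondec_le_def)
    then show ?thesis
      using E_tree_singleton[OF f k, of "hd s"] by (metis hd_append2 list.discI prefixE strict_prefixE)
  qed simp
qed

text \<open>On singletons \<prec> is the order of the entries, and heads of values are determined on
  singletons.\<close>

lemma E_tree_hd_less:
  assumes f: "E_tree k f" and "s \<in> nondec_le k" "s \<noteq> []" "t \<in> nondec_le k" "t \<noteq> []"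
    and "hd s < hd t"
  shows "hd (f s) < hd (f t)"
proof -
  have k: "1 \<le> k" using assms(2,3) by (cases s) (auto simp: nondec_le_def)
  have "f [hd s] \<prec> f [hd t]"
    using k assms(6) by (intro E_treeD(2)[OF f]) (auto simp: nondec_le_def prec_def)
  then have "hd (f [hd s]) < hd (f [hd t])"
    by (subst (asm) (1 2) E_tree_singleton[OF f k]) (auto simp: prec_def less_than_iff)
  then show ?thesis
    using assms E_tree_hd[OF f] by simp
qed

text \<open>Strict separation of the bands. A tie of last entries would have to be broken
  lexicographically, which is impossible: either the two values share everything but the last entry,
  or their heads are in the wrong order.\<close>

lemma E_tree_last_less:
  assumes f: "E_tree k f" and w: "w \<in> nondec_le k" "w \<noteq> []" and b: "b < last w"
  shows "last (f (replicate k b)) < last (f w)"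
proof -
  obtain m where m: "k = Suc m" using w by (cases k) (auto simp: nondec_le_def)
  \<comment> \<open>\<open>?z\<close> is the least sequence ending in \<open>last w\<close>, so by
    monotonicity it suffices to treat \<open>?z\<close> instead of \<open>w\<close>.\<close>
  let ?b = "replicate k b" and ?z = "replicate m 0 @ [last w]"
  have mem: "?b \<in> nondec_le k" "?z \<in> nondec_le k"
    by (auto simp: nondec_le_def m sorted_append)
  have ne: "f ?b \<noteq> []" "f ?z \<noteq> []"
    using E_tree_length[OF f mem(1)] E_tree_length[OF f mem(2)] m by auto
  have "f ?z \<preceq> f w"
    using zeros_snoc_prec_eq[of w m] w b m mem by (intro E_tree_prec_eq[OF f]) auto
  then have le: "last (f ?z) \<le> last (f w)"
    using prec_imp_last_le ne(2) by auto
  have "f ?b \<prec> f ?z"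
    using b mem m by (intro E_treeD(2)[OF f]) (auto simp: prec_def)
  then have bz: "last (f ?b) < last (f ?z) \<or> (f ?b, f ?z) \<in> lexord less_than"
    and bz_le: "last (f ?b) \<le> last (f ?z)"
    using ne by (auto simp: prec_def)
  have "last (f ?b) \<noteq> last (f ?z)"
  \<comment> \<open>In the first case \<open>?b\<close> and \<open>?z\<close> are children of the
    same node (0,...,0), so their images differ at most in the last entry.\<close>
  proof (cases "m = 0 \<or> b = 0")
    case True
    then have eq: "?b = replicate m 0 @ [b]"
      by (auto simp: m replicate_append_same)
    have z: "replicate m 0 \<in> nondec_le k" by (simp add: nondec_le_def m)
    have "butlast (f (replicate m 0 @ [c])) = f (replicate m 0)" for c
    proof -
      have mem: "replicate m 0 @ [c] \<in> nondec_le k"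
        by (auto simp: nondec_le_def m sorted_append)
      have "strict_prefix (f (replicate m 0)) (f (replicate m 0 @ [c]))"
        using z mem by (intro E_treeD(3)[OF f]) (auto simp: strict_prefix_def)
      moreover have "length (f (replicate m 0 @ [c])) = Suc (length (f (replicate m 0)))"
        using E_tree_length[OF f z] E_tree_length[OF f mem] by simp
      ultimately obtain z where "f (replicate m 0 @ [c]) = f (replicate m 0) @ z" "length z = 1"
        by (auto simp: strict_prefix_def prefix_def)
      then show ?thesis by (auto simp: length_Suc_conv)
    qed
    then have "butlast (f ?b) = butlast (f ?z)" using eq by simp
    then have "last (f ?b) = last (f ?z) \<Longrightarrow> f ?b = f ?z"
      using ne by (metis append_butlast_last_id)
    with \<open>f ?b \<prec> f ?z\<close> show ?thesis using prec_irrefl by metis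
  next
    case False
    \<comment> \<open>\<open>?z\<close> starts with 0 and \<open>?b\<close> with
      \<open>b > 0\<close>; the order of the heads defeats the lexicographic alternative in
      \<open>bz\<close>.\<close>
    then have "hd (f ?z) < hd (f ?b)"
      using mem m by (intro E_tree_hd_less[OF f]) (auto simp: hd_append)
    then have "(f ?b, f ?z) \<notin> lexord less_than"
      using ne by (cases "f ?b"; cases "f ?z") (auto simp: less_than_iff)
    with bz show ?thesis by auto
  qed
  with bz_le le show ?thesis by simp
qed

text \<open>On the branches through \<open>(0)\<close> the new tree is \<open>f\<close> shifted by \<open>\<Phi>\<close>. Elsewhere each
  coordinate \<open>b\<close> goes to the largest last entry \<open>f\<close> attains on sequences ending in \<open>b\<close>, which lies
  strictly below all last entries attained on sequences ending in \<open>b + 1\<close>.\<close>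

definition lift_tree :: "nat \<Rightarrow> (nat list \<Rightarrow> nat list) \<Rightarrow> nat list \<Rightarrow> nat list" where
  "lift_tree k f s =
     (if s = [] then []
      else if hd s = 0 then Phi (f (tl s))
      else map (\<lambda>b. last (f (replicate k b))) s)"

lemma lift_tree_Phi: "lift_tree k f (Phi s) = Phi (f s)"
  by (simp add: lift_tree_def Phi_def)

lemma list_zero_cases:
  obtains "s = []" | u where "s = Phi u" | "s \<noteq> []" "hd s > (0::nat)"
  by (cases s) (auto simp: Phi_def)

lemma lexord_map_strict_mono:
  assumes "strict_mono (g :: nat \<Rightarrow> nat)"
  shows "(s, t) \<in> lexord less_than \<Longrightarrow> (map g s, map g t) \<in> lexord less_than"
proof (induction s arbitrary: t)
  case Nil
  then show ?case by (cases t) auto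
next
  case (Cons a s)
  then show ?case using strict_monoD[OF assms] by (cases t) (auto simp: less_than_iff)
qed

text \<open>The issue is \<prec> between the two kinds of branches, and it dictates
  \<open>L\<close>. Going from a \<Phi>-branch to another one, a tie of last entries is allowed
  because head 0 wins lexicographically, so \<open>L b\<close> must be at least every last entry of
  \<open>f\<close> on sequences ending in \<open>b\<close>. In the opposite direction last entries
  must increase strictly, so \<open>L b\<close> must stay below those on sequences with larger last
  entry.\<close>

lemma E_tree_lift_tree:
  assumes f: "E_tree k f" and k: "1 \<le> k"
  shows "E_tree (k + 1) (lift_tree k f)"
proof -
  define L where "L b = last (f (replicate k b))" for b
  have rep: "replicate k b \<in> nondec_le k" for b
    by (simp add: nondec_le_def)
  have L_less: "L b < last (f w)" if "w \<in> nondec_le k" "w \<noteq> []" "b < last w" for b w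
    unfolding L_def using E_tree_last_less[OF f that] .
  have L_mono: "strict_mono L"
    unfolding strict_mono_def
  proof safe
    fix a b :: nat assume "a < b"
    then show "L a < L b" using L_less[of "replicate k b" a] rep k by (simp add: L_def)
  qed
  \<comment> \<open>\<open>replicate k (last u)\<close> is the top of the band containing
    \<open>u\<close>, and \<open>f\<close> is monotone.\<close>
  have L_ge: "last (f u) \<le> L (last u)" if "u \<in> nondec_le k" "u \<noteq> []" for u
  proof -
    have "f u \<noteq> []" using E_tree_length[OF f] that by fastforce
    moreover have "f u \<preceq> f (replicate k (last u))"
      using that rep by (intro E_tree_prec_eq[OF f] prec_eq_replicate_last) auto
    ultimately show ?thesis using prec_imp_last_le unfolding L_def by auto
  qed
  have nil: "lift_tree k f [] = []"
    by (simp add: lift_tree_def)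
  have zero: "lift_tree k f (Phi u) = Phi (f u)" for u
    by (rule lift_tree_Phi)
  have pos: "lift_tree k f s = map L s" if "s \<noteq> []" "hd s > 0" for s
    using that by (simp add: lift_tree_def L_def)
  have L_pos: "L b > 0" if "b > 0" for b
    using strict_monoD[OF L_mono that] by simp
  have f_ne: "f u \<noteq> []" if "u \<in> nondec_le k" "u \<noteq> []" for u
    using E_tree_length[OF f] that by fastforce
  have f_nil: "f [] = []"
    using E_tree_length[OF f, of "[]"] by (simp add: nondec_le_def)
  have maps: "lift_tree k f s \<in> nondec_le (k + 1)" if s: "s \<in> nondec_le (k + 1)" for s
  proof (cases s rule: list_zero_cases)
    case 1
    then show ?thesis by (simp add: nil nondec_le_def)
  next
    case (2 u)
    then show ?thesis using s E_treeD(1)[OF f] by (simp only: zero Phi_mem_nondec_le_iff)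
  next
    case 3
    have "sorted (map L s)"
      using s strict_mono_mono[OF L_mono]
      by (auto simp: nondec_le_def sorted_map monoD elim: sorted_wrt_mono_rel[rotated])
    then show ?thesis using s 3 by (simp add: pos nondec_le_def)
  qed
  have mono: "lift_tree k f s \<prec> lift_tree k f t"
    if s: "s \<in> nondec_le (k + 1)" and t: "t \<in> nondec_le (k + 1)" and st: "s \<prec> t" for s t
  proof (cases t rule: list_zero_cases)
    case 1
    then show ?thesis using st by (simp add: prec_def)
  next
    case tw: (2 w)
    have w: "w \<in> nondec_le k" using t tw Phi_mem_nondec_le_iff by blast
    show ?thesis
    proof (cases s rule: list_zero_cases)
      case 1
      then show ?thesis unfolding 1 nil tw zero by (simp add: prec_def Phi_def)
    next
      case (2 u)
      then show ?thesis
        using s st w E_treeD(2)[OF f] by (simp add: tw zero Phi_prec_iff Phi_mem_nondec_le_iff[simplified])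
    next
      case 3
      \<comment> \<open>A tie would be decided by the heads against \<open>s\<close>, because
        \<open>t\<close> has head 0.\<close>
      have less: "last s < last t"
      proof (rule ccontr)
        assume "\<not> last s < last t"
        then have "(s, t) \<in> lexord less_than" using st 3 by (auto simp: prec_def)
        then show False using 3 tw by (cases s) (auto simp: Phi_def less_than_iff)
      qed
      then have "w \<noteq> []" using tw by (auto simp: Phi_def)
      then have "L (last s) < last (f w)"
        using less w tw by (intro L_less) (auto simp: Phi_def)
      then show ?thesis
        using f_ne[OF w \<open>w \<noteq> []\<close>] 3 unfolding tw zero pos[OF 3]
        by (simp add: prec_def Phi_def last_map)
    qed
  next
    case tpos: 3
    show ?thesis
    proof (cases s rule: list_zero_cases)
      case 1
      then show ?thesis using tpos by (simp add: nil pos prec_def)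
    next
      case su: (2 u)
      have u: "u \<in> nondec_le k" using s su Phi_mem_nondec_le_iff by blast
      \<comment> \<open>Head 0 meets a positive value of \<open>L\<close>; only a weak inequality of
        last entries remains to be shown.\<close>
      have lex: "(Phi (f u), map L t) \<in> lexord less_than"
        using tpos L_pos by (cases t) (auto simp: Phi_def less_than_iff)
      have "last (Phi (f u)) \<le> L (last t)"
      proof (cases "u = []")
        case True
        then show ?thesis by (simp add: f_nil Phi_def)
      next
        case False
        have "last (f u) \<le> L (last u)" using L_ge u False by blast
        also have "last u \<le> last t"
          using prec_imp_last_le[OF st] su False by (simp add: Phi_def)
        then have "L (last u) \<le> L (last t)" using strict_mono_less_eq[OF L_mono] by blast
        finally show ?thesis using f_ne[OF u False] by (simp add: Phi_def)
      qed
      then show ?thesis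
        using lex tpos su by (auto simp: pos zero prec_def last_map)
    next
      case 3
      then show ?thesis
        using st tpos lexord_map_strict_mono[OF L_mono, of s t] strict_monoD[OF L_mono]
        by (auto simp: pos prec_def last_map)
    qed
  qed
  have prefix: "strict_prefix (lift_tree k f s) (lift_tree k f t)"
    if s: "s \<in> nondec_le (k + 1)" and t: "t \<in> nondec_le (k + 1)" and st: "strict_prefix s t" for s t
  proof -
    from st obtain r where r: "t = s @ r" "r \<noteq> []"
      by (auto simp: strict_prefix_def prefix_def)
    show ?thesis
    proof (cases s rule: list_zero_cases)
      case 1
      then show ?thesis using r by (auto simp: lift_tree_def Phi_def strict_prefix_def)
    next
      case (2 u)
      then have tu: "t = Phi (u @ r)" using r by (simp add: Phi_def)
      have "strict_prefix (f u) (f (u @ r))"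
        using s t 2 tu r by (intro E_treeD(3)[OF f]) (auto simp: Phi_mem_nondec_le_iff[simplified] strict_prefix_def)
      then show ?thesis unfolding 2 tu zero by (simp add: Phi_def)
    next
      case 3
      then have "t \<noteq> []" "hd t > 0" using r by auto
      with 3 show ?thesis using r by (simp add: pos strict_prefix_def)
    qed
  qed
  show ?thesis
    unfolding E_tree_def Pi_iff by (intro conjI ballI impI) (rule maps mono prefix; assumption)+
qed

text \<open>Heads of values depend only on heads of arguments, so \<open>f\<close> maps the branch
  through (0) into itself. Since \<Phi> preserves and reflects \<prec> and strict prefixes,
  stripping the leading 0 on both sides leaves a tree.\<close>

lemma E_tree_restrict:
  assumes f: "E_tree (k + 1) f" and f0: "f [0] = [0]"
  shows "E_tree k (\<lambda>u. tl (f (Phi u)))"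
    and "u \<in> nondec_le k \<Longrightarrow> f (Phi u) = Phi (tl (f (Phi u)))"
proof -
  have eq: "f (Phi u) = Phi (tl (f (Phi u)))" if "u \<in> nondec_le k" for u
  proof -
    have mem: "Phi u \<in> nondec_le (k + 1)" using that by (simp only: Phi_mem_nondec_le_iff)
    then have "length (f (Phi u)) = Suc (length u)"
      using E_tree_length[OF f] by (simp add: Phi_def)
    moreover have "hd (f (Phi u)) = 0"
      using E_tree_hd[OF f mem] f0 by (simp add: Phi_def)
    ultimately show ?thesis by (cases "f (Phi u)") (auto simp: Phi_def)
  qed
  then show "u \<in> nondec_le k \<Longrightarrow> f (Phi u) = Phi (tl (f (Phi u)))" .
  show "E_tree k (\<lambda>u. tl (f (Phi u)))"
    unfolding E_tree_def
  proof safe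
    fix u assume u: "u \<in> nondec_le k"
    then have "f (Phi u) \<in> nondec_le (k + 1)"
      using E_treeD(1)[OF f] by (simp only: Phi_mem_nondec_le_iff)
    then show "tl (f (Phi u)) \<in> nondec_le k"
      using eq[OF u] Phi_mem_nondec_le_iff by metis
  next
    fix u w assume u: "u \<in> nondec_le k" and w: "w \<in> nondec_le k"
    then have mem: "Phi u \<in> nondec_le (k + 1)" "Phi w \<in> nondec_le (k + 1)"
      by (simp_all only: Phi_mem_nondec_le_iff)
    show "tl (f (Phi u)) \<prec> tl (f (Phi w))" if "u \<prec> w"
      using E_treeD(2)[OF f mem] that eq[OF u] eq[OF w] Phi_prec_iff by metis
    show "strict_prefix (tl (f (Phi u))) (tl (f (Phi w)))" if "strict_prefix u w"
    proof -
      have "strict_prefix (Phi u) (Phi w)" using that by (simp add: Phi_def)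
      from E_treeD(3)[OF f mem this] have "strict_prefix (Phi (tl (f (Phi u)))) (Phi (tl (f (Phi w))))"
        using eq[OF u] eq[OF w] by simp
      then show ?thesis by (simp add: Phi_def)
    qed
  qed
qed

section \<open>Finite approximations\<close>

lemma E_space_subset_nondec: "X \<in> E_space k \<Longrightarrow> X \<subseteq> nondec k"
  using E_tree_image_nondec by (auto simp: E_space_def)

text \<open>Trades counting for downward closure, which passes through \<Phi> easily. The rank
  \<open>rk X\<close> is strictly increasing, hence injective, on \<open>X\<close>, so the sets of
  rank below some \<open>n \<ge> 1\<close> are exactly the non-empty finite initial
  segments.\<close>

lemma AR_iff:
  "E \<in> AR k \<longleftrightarrow> E \<noteq> {} \<and> finite E \<and>
     (\<exists>X\<in>E_space k. E \<subseteq> X \<and> (\<forall>x\<in>E. \<forall>y\<in>X. y \<prec> x \<longrightarrow> y \<in> E))"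
proof -
  define rk where "rk X x = card {y \<in> X. y \<prec> x}" for X :: "nat list set" and x
  have fin: "finite {y \<in> X. y \<prec> x}" if "X \<in> E_space k" for X x
    using E_space_subset_nondec[OF that] by (intro finite_subset[OF _ finite_prec_nondec[of k x]]) auto
  have rk_less: "rk X x < rk X y" if "X \<in> E_space k" "x \<in> X" "x \<prec> y" for X x y
    unfolding rk_def
  proof (rule psubset_card_mono[OF fin[OF that(1)]])
    show "{z \<in> X. z \<prec> x} \<subset> {z \<in> X. z \<prec> y}"
      using that prec_trans prec_irrefl by blast
  qed
  have rk_inj: "inj_on (rk X) X" if "X \<in> E_space k" for X
    using rk_less[OF that] prec_total by (intro inj_onI) (metis nat_neq_iff)
  have least: "least_elems n X = {x \<in> X. rk X x < n}" for n X
    by (simp add: least_elems_def rk_def)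
  show ?thesis (is "_ \<longleftrightarrow> ?R")
  proof
    assume "E \<in> AR k"
    then obtain n X where X: "X \<in> E_space k" and n: "1 \<le> n" and E: "E = {x \<in> X. rk X x < n}"
      by (auto simp: AR_def least)
    from X have "X \<noteq> {}" using replicate_mem_nondec by (fastforce simp: E_space_def)
    then obtain x where x: "x \<in> X" "\<And>y. y \<in> X \<Longrightarrow> rk X x \<le> rk X y"
      using ex_has_least_nat[of "\<lambda>x. x \<in> X" _ "rk X"] by (metis ex_in_conv)
    \<comment> \<open>The element of least rank has rank 0 and therefore belongs to \<open>E\<close>
      whenever \<open>n \<ge> 1\<close>.\<close>
    have "{y \<in> X. y \<prec> x} = {}"
      using x(2) rk_less[OF X] by (auto simp flip: not_le)
    then have "rk X x = 0" unfolding rk_def by (metis card.empty)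
    then have "x \<in> E" using x(1) n E by simp
    then have "E \<noteq> {}" by blast
    have "rk X ` E \<subseteq> {..<n}" "inj_on (rk X) E"
      using E rk_inj[OF X] by (auto intro: inj_on_subset)
    then have "finite E" by (meson finite_imageD finite_lessThan finite_subset)
    have "\<forall>x\<in>E. \<forall>y\<in>X. y \<prec> x \<longrightarrow> y \<in> E"
      using E rk_less[OF X] by fastforce
    moreover have "E \<subseteq> X" using E by blast
    ultimately show ?R using X \<open>E \<noteq> {}\<close> \<open>finite E\<close> by blast
  next
    assume ?R
    then obtain X where ne: "E \<noteq> {}" and "finite E" and X: "X \<in> E_space k" and "E \<subseteq> X"
      and down: "\<forall>x\<in>E. \<forall>y\<in>X. y \<prec> x \<longrightarrow> y \<in> E"
      by blast
    define m where "m = Max (rk X ` E)"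
    have "m \<in> rk X ` E" unfolding m_def using ne \<open>finite E\<close> by (intro Max_in) auto
    then obtain x where x: "x \<in> E" "m = rk X x" by blast
    \<comment> \<open>Ranks count from 0, so the top rank \<open>m\<close> of \<open>E\<close>
      corresponds to \<open>Suc m\<close> least elements.\<close>
    have "E = {y \<in> X. rk X y < Suc m}"
    proof (intro set_eqI iffI CollectI conjI)
      fix y assume y: "y \<in> {y \<in> X. rk X y < Suc m}"
      then have "\<not> x \<prec> y" using rk_less[OF X, of x y] x \<open>E \<subseteq> X\<close> by auto
      then have "y \<preceq> x" using prec_total by blast
      then show "y \<in> E" using down x y by blast
    next
      fix y assume "y \<in> E"
      then show "y \<in> X" using \<open>E \<subseteq> X\<close> by blast
      have "rk X y \<le> m" unfolding m_def using \<open>finite E\<close> \<open>y \<in> E\<close> by (intro Max_ge) auto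
      then show "rk X y < Suc m" by simp
    qed
    then have "E = least_elems (Suc m) X" by (simp add: least)
    then show "E \<in> AR k" using X unfolding AR_def by force
  qed
qed

lemma AR_nonempty: "AR k \<noteq> {}"
proof -
  have "E_tree k (\<lambda>s. s)" by (auto simp: E_tree_def)
  then have "nondec k \<in> E_space k" by (force simp: E_space_def)
  then have "least_elems 1 (nondec k) \<in> AR k" by (auto simp: AR_def)
  then show ?thesis by blast
qed

text \<open>One value in the range of \<Phi> already forces \<open>f [0] = [0]\<close>. The
  restricted tree \<open>g\<close> then has as image exactly the \<Phi>-preimage of the image of
  \<open>f\<close>, and initial segments pull back.\<close>

lemma vimage_Phi_AR:
  assumes E: "E \<in> AR (k + 1)" and ne: "Phi -` E \<noteq> {}"
  shows "Phi -` E \<in> AR k"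
proof -
  from E obtain f where f: "E_tree (k + 1) f" and EX: "E \<subseteq> f ` nondec (k + 1)" and "finite E"
    and down: "\<And>x y. x \<in> E \<Longrightarrow> y \<in> f ` nondec (k + 1) \<Longrightarrow> y \<prec> x \<Longrightarrow> y \<in> E"
    unfolding AR_iff E_space_def by blast
  have mem: "s \<in> nondec_le (k + 1)" "s \<noteq> []" if "s \<in> nondec (k + 1)" for s
    using that by (auto simp: nondec_def nondec_le_def)
  have mem0: "[0] \<in> nondec_le (k + 1)" by (simp add: nondec_le_def)
  have hd0: "hd s = 0 \<and> hd (f [0]) = 0" if "s \<in> nondec (k + 1)" "f s = Phi v" for s v
  proof -
    \<comment> \<open>A positive head of \<open>s\<close> would make the head of \<open>f s\<close>
      larger than that of \<open>f [0]\<close>, hence positive.\<close>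
    have "\<not> hd [0] < hd s"
      using E_tree_hd_less[OF f mem0 _ mem[OF that(1)]] that by (auto simp: Phi_def)
    then show ?thesis
      using E_tree_hd[OF f mem[OF that(1)]] that by (simp add: Phi_def)
  qed
  from ne EX obtain v where "Phi v \<in> f ` nondec (k + 1)" by blast
  then obtain s where "s \<in> nondec (k + 1)" "f s = Phi v" by (metis imageE)
  then have f0: "f [0] = [0]"
    using hd0 E_tree_singleton[OF f, of 0] by simp
  define g where "g u = tl (f (Phi u))" for u
  have g: "E_tree k g" and fg: "\<And>u. u \<in> nondec_le k \<Longrightarrow> f (Phi u) = Phi (g u)"
    using E_tree_restrict[OF f f0] by (simp_all add: g_def[abs_def])
  have Phi_image: "Phi v \<in> f ` nondec (k + 1) \<longleftrightarrow> v \<in> g ` nondec k" for v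
  proof
    assume "Phi v \<in> f ` nondec (k + 1)"
    then obtain s where s: "s \<in> nondec (k + 1)" "f s = Phi v" by (metis imageE)
    have "s = Phi (tl s)" using hd0[OF s] mem(2)[OF s(1)] by (cases s) (auto simp: Phi_def)
    then obtain u where u: "s = Phi u" by blast
    then have "u \<in> nondec k" using s Phi_mem_nondec_iff by blast
    moreover from this have "g u = v"
      using fg s u nondec_subset_nondec_le injD[OF inj_Phi] by fastforce
    ultimately show "v \<in> g ` nondec k" by blast
  next
    assume "v \<in> g ` nondec k"
    then obtain u where u: "u \<in> nondec k" "v = g u" by blast
    then have "Phi v = f (Phi u)" using fg[of u] nondec_subset_nondec_le[of k] by (simp add: subset_iff)
    then show "Phi v \<in> f ` nondec (k + 1)" using u Phi_mem_nondec_iff by blast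
  qed
  have "g ` nondec k \<in> E_space k" using g by (auto simp: E_space_def)
  moreover have "Phi -` E \<subseteq> g ` nondec k" using EX Phi_image by blast
  moreover have "\<forall>x\<in>Phi -` E. \<forall>y\<in>g ` nondec k. y \<prec> x \<longrightarrow> y \<in> Phi -` E"
  proof (intro ballI impI vimageI2)
    fix x y assume "x \<in> Phi -` E" "y \<in> g ` nondec k" "y \<prec> x"
    then have "Phi x \<in> E" "Phi y \<in> f ` nondec (k + 1)" "Phi y \<prec> Phi x"
      by (simp_all only: Phi_image Phi_prec_iff vimage_eq)
    then show "Phi y \<in> E" by (rule down)
  qed
  moreover have "finite (Phi -` E)" using \<open>finite E\<close> inj_Phi by (rule finite_vimageI)
  ultimately show ?thesis using ne unfolding AR_iff by blast
qed

text \<open>The last two conclusions say, without naming extrema, that \<open>E'\<close> lies in the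
  \<prec>-interval spanned by \<Phi>[E]; this is the form needed to keep blocks apart.\<close>

lemma AR_lift:
  assumes E: "E \<in> AR k" and k: "1 \<le> k"
  obtains E' where "E' \<in> AR (k + 1)" "Phi -` E' = E"
    "\<And>y. y \<in> E' \<Longrightarrow> \<exists>x\<in>E. y \<preceq> Phi x" "\<And>y. y \<in> E' \<Longrightarrow> \<exists>x\<in>E. Phi x \<preceq> y"
proof -
  from E obtain f where f: "E_tree k f" and EX: "E \<subseteq> f ` nondec k" and "finite E" and ne: "E \<noteq> {}"
    and down: "\<And>x y. x \<in> E \<Longrightarrow> y \<in> f ` nondec k \<Longrightarrow> y \<prec> x \<Longrightarrow> y \<in> E"
    unfolding AR_iff E_space_def by blast
  define f' where "f' = lift_tree k f"
  define Y where "Y = f' ` nondec (k + 1)"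
  \<comment> \<open>Cutting the lifted image at the top of \<Phi>[E] gives a downward closed set,
    finite because points have finitely many predecessors.\<close>
  define E' where "E' = {y \<in> Y. \<exists>x\<in>E. y \<preceq> Phi x}"
  have f': "E_tree (k + 1) f'"
    unfolding f'_def using f k by (rule E_tree_lift_tree)
  have f'_Phi: "f' (Phi u) = Phi (f u)" for u
    by (simp add: f'_def lift_tree_Phi)
  have Y: "Y \<in> E_space (k + 1)" using f' by (auto simp: Y_def E_space_def)
  \<comment> \<open>Arguments with positive head have values with positive head, so the lift adds
    nothing inside the range of \<Phi>.\<close>
  have Phi_Y: "Phi v \<in> Y \<longleftrightarrow> v \<in> f ` nondec k" for v
  proof
    assume "Phi v \<in> Y"
    then obtain s where s: "s \<in> nondec (k + 1)" "f' s = Phi v" unfolding Y_def by (metis imageE)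
    have mem: "s \<in> nondec_le (k + 1)" "s \<noteq> []" "[0] \<in> nondec_le (k + 1)"
      using s by (auto simp: nondec_def nondec_le_def)
    have "\<not> hd [0] < hd s"
      using E_tree_hd_less[OF f' mem(3) _ mem(1,2)] s by (auto simp: Phi_def)
    then have "s = Phi (tl s)" using mem(2) by (cases s) (auto simp: Phi_def)
    then obtain u where u: "s = Phi u" by blast
    then have "f u = v" using s f'_Phi injD[OF inj_Phi] by fastforce
    then show "v \<in> f ` nondec k" using u s Phi_mem_nondec_iff by blast
  next
    assume "v \<in> f ` nondec k"
    then show "Phi v \<in> Y" unfolding Y_def using f'_Phi Phi_mem_nondec_iff by (metis image_iff)
  qed
  have pre: "Phi -` E' = E"
  proof
    show "E \<subseteq> Phi -` E'" using EX by (auto simp: E'_def Phi_Y)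
    show "Phi -` E' \<subseteq> E"
      using down by (auto simp: E'_def Phi_Y Phi_prec_iff dest: injD[OF inj_Phi])
  qed
  have "E' \<subseteq> (\<Union>x\<in>E. insert (Phi x) {y \<in> nondec (k + 1). y \<prec> Phi x})"
    using E_space_subset_nondec[OF Y] by (auto simp: E'_def)
  moreover have "finite (\<Union>x\<in>E. insert (Phi x) {y \<in> nondec (k + 1). y \<prec> Phi x})"
    using \<open>finite E\<close> finite_prec_nondec by auto
  ultimately have "finite E'" by (rule finite_subset)
  moreover have "E' \<noteq> {}" using pre ne by auto
  moreover have "\<forall>x\<in>E'. \<forall>y\<in>Y. y \<prec> x \<longrightarrow> y \<in> E'"
    using prec_trans unfolding E'_def by blast
  ultimately have "E' \<in> AR (k + 1)"
    using Y unfolding AR_iff by (auto simp: E'_def)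
  moreover have "\<exists>x\<in>E. Phi x \<preceq> y" if "y \<in> E'" for y
  proof -
    \<comment> \<open>The least point of the image of \<open>f\<close>, hence in the non-empty
      initial segment \<open>E\<close>; its \<Phi>-image is the least point of
      \<open>Y\<close>.\<close>
    let ?m = "f (replicate k 0)"
    have rep: "replicate k 0 \<in> nondec k" by (rule replicate_mem_nondec)
    have "?m \<in> E"
    proof -
      from ne EX obtain s where s: "s \<in> nondec k" "f s \<in> E" by blast
      then have "?m \<preceq> f s"
        using rep nondec_subset_nondec_le zeros_prec_eq by (intro E_tree_prec_eq[OF f]) auto
      then show ?thesis using down[OF s(2), of ?m] s(2) rep by auto
    qed
    moreover have "Phi ?m \<preceq> y"
    proof -
      from that obtain s where s: "s \<in> nondec (k + 1)" "y = f' s" by (auto simp: E'_def Y_def)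
      have "Phi ?m = f' (replicate (k + 1) 0)" using f'_Phi[of "replicate k 0"] by (simp add: Phi_def)
      moreover have "f' (replicate (k + 1) 0) \<preceq> f' s"
        using s replicate_mem_nondec nondec_subset_nondec_le zeros_prec_eq
        by (intro E_tree_prec_eq[OF f']) blast+
      ultimately show ?thesis using s by simp
    qed
    ultimately show ?thesis by blast
  qed
  moreover have "\<exists>x\<in>E. y \<preceq> Phi x" if "y \<in> E'" for y
    using that by (simp add: E'_def)
  ultimately show ?thesis using pre by (intro that[of E'])
qed

text \<open>Makes the suprema over admissible families range over non-empty sets, as
  least-upper-bound arguments in the reals require.\<close>

lemma ex_admissible: "1 \<le> d \<Longrightarrow> \<exists>Es. admissible k d Es"
proof -
  assume "1 \<le> d"
  moreover obtain E where "E \<in> AR k" using AR_nonempty by blast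
  ultimately have "admissible k d [E]" by (simp add: admissible_def)
  then show ?thesis ..
qed

text \<open>Members of \<open>AR k\<close> are non-empty, so empty preimages must be dropped,
  possibly all of them. The order is transferred before filtering, which is sound because
  \<open>block_less\<close> holds vacuously for empty sets.\<close>

lemma admissible_vimage_Phi:
  assumes "admissible (k + 1) d Es"
  defines "Es' \<equiv> filter (\<lambda>E. E \<noteq> {}) (map ((-`) Phi) Es)"
  shows "Es' = [] \<or> admissible k d Es'"
proof -
  have "length Es' \<le> length Es"
    unfolding Es'_def by (metis length_filter_le length_map)
  then have "length Es' \<le> d"
    using assms(1) by (simp add: admissible_def)
  moreover have "set Es' \<subseteq> AR k"
    using assms(1) vimage_Phi_AR by (auto simp: admissible_def Es'_def)
  moreover have "sorted_wrt (\<lambda>E F. block_less (Phi -` E) (Phi -` F)) Es"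
  proof (rule sorted_wrt_mono_rel)
    show "sorted_wrt block_less Es" using assms(1) by (simp add: admissible_def)
    show "block_less (Phi -` E) (Phi -` F)" if "block_less E F" for E F
      unfolding block_less_def
    proof (intro ballI)
      fix u v assume "u \<in> Phi -` E" "v \<in> Phi -` F"
      then have "Phi u \<prec> Phi v" using that by (simp add: block_less_def)
      then show "u \<prec> v" by (simp only: Phi_prec_iff)
    qed
  qed
  then have "sorted_wrt block_less Es'"
    unfolding Es'_def by (intro sorted_wrt_filter) (simp add: sorted_wrt_map)
  ultimately have "admissible k d Es'" if "Es' \<noteq> []"
    using that by (simp add: admissible_def Suc_le_eq)
  then show ?thesis by blast
qed

text \<open>For \<open>u\<close> in \<open>up E\<close> and \<open>v\<close> in \<open>up F\<close>
  the chain \<open>u \<preceq> Phi x \<prec> Phi y \<preceq> v\<close>, with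
  \<open>x \<in> E\<close> and \<open>y \<in> F\<close>, separates the enlarged blocks.\<close>

lemma admissible_lift:
  assumes "admissible k d Es" and k: "1 \<le> k"
  obtains Es' where "admissible (k + 1) d Es'" "map ((-`) Phi) Es' = Es"
proof -
  have "\<exists>E'. E' \<in> AR (k + 1) \<and> Phi -` E' = E \<and>
      (\<forall>y\<in>E'. (\<exists>x\<in>E. y \<preceq> Phi x) \<and> (\<exists>x\<in>E. Phi x \<preceq> y))" if "E \<in> AR k" for E
    by (rule AR_lift[OF that k]) blast
  then have "\<exists>up. \<forall>E\<in>AR k. up E \<in> AR (k + 1) \<and> Phi -` up E = E \<and>
      (\<forall>y\<in>up E. (\<exists>x\<in>E. y \<preceq> Phi x) \<and> (\<exists>x\<in>E. Phi x \<preceq> y))"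
    by (intro bchoice ballI)
  then obtain up where up_all: "\<forall>E\<in>AR k. up E \<in> AR (k + 1) \<and> Phi -` up E = E \<and>
      (\<forall>y\<in>up E. (\<exists>x\<in>E. y \<preceq> Phi x) \<and> (\<exists>x\<in>E. Phi x \<preceq> y))" ..
  then have up: "\<And>E. E \<in> AR k \<Longrightarrow> up E \<in> AR (k + 1)" "\<And>E. E \<in> AR k \<Longrightarrow> Phi -` up E = E"
    and up_ge: "\<And>E y. E \<in> AR k \<Longrightarrow> y \<in> up E \<Longrightarrow> \<exists>x\<in>E. y \<preceq> Phi x"
    and up_le: "\<And>E y. E \<in> AR k \<Longrightarrow> y \<in> up E \<Longrightarrow> \<exists>x\<in>E. Phi x \<preceq> y"
    by simp_all
  have sub: "set Es \<subseteq> AR k" and sorted: "sorted_wrt block_less Es"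
    using assms(1) by (simp_all add: admissible_def)
  have "block_less (up E) (up F)" if EF: "E \<in> AR k" "F \<in> AR k" "block_less E F" for E F
    unfolding block_less_def
  proof safe
    fix u v assume "u \<in> up E" "v \<in> up F"
    obtain x where x: "x \<in> E" "u \<preceq> Phi x" using up_ge[OF EF(1) \<open>u \<in> up E\<close>] ..
    obtain y where y: "y \<in> F" "Phi y \<preceq> v" using up_le[OF EF(2) \<open>v \<in> up F\<close>] ..
    have "Phi x \<prec> Phi y" using EF(3) x y by (simp add: block_less_def Phi_prec_iff)
    then show "u \<prec> v" using x(2) y(2) prec_trans by blast
  qed
  then have "sorted_wrt (\<lambda>E F. block_less (up E) (up F)) Es"
    using sub by (intro sorted_wrt_mono_rel[OF _ sorted]) blast
  then have "sorted_wrt block_less (map up Es)"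
    by (simp add: sorted_wrt_map)
  then have "admissible (k + 1) d (map up Es)"
    using assms(1) sub up(1) by (auto simp: admissible_def)
  moreover have "map ((-`) Phi) (map up Es) = Es"
    unfolding map_map using sub up(2) by (intro map_idI) auto
  ultimately show ?thesis by (rule that)
qed

section \<open>The norm\<close>

abbreviation finite_supp :: "vec \<Rightarrow> bool" where
  "finite_supp x \<equiv> finite {v. x v \<noteq> 0}"

lemma finite_supp_restr: "finite_supp x \<Longrightarrow> finite_supp (restr E x)"
  by (erule finite_subset[rotated]) (auto simp: restr_def)

lemma finite_supp_add: "finite_supp x \<Longrightarrow> finite_supp y \<Longrightarrow> finite_supp (\<lambda>v. x v + y v)"
  by (rule finite_subset[of _ "{v. x v \<noteq> 0} \<union> {v. y v \<noteq> 0}"]) auto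

lemma finite_supp_scale: "finite_supp x \<Longrightarrow> finite_supp (\<lambda>v. c * x v)"
  by (erule finite_subset[rotated]) auto

lemma restr_add: "restr E (\<lambda>v. x v + y v) = (\<lambda>v. restr E x v + restr E y v)"
  by (auto simp: restr_def)

lemma restr_scale: "restr E (\<lambda>v. c * x v) = (\<lambda>v. c * restr E x v)"
  by (auto simp: restr_def)

text \<open>Successive blocks are disjoint because \<prec> is irreflexive, so no coefficient is
  counted twice.\<close>

lemma sum_list_block_le:
  assumes "sorted_wrt block_less Es" "finite S"
  shows "(\<Sum>E\<leftarrow>Es. \<Sum>v\<in>S \<inter> E. \<bar>x v\<bar>) \<le> (\<Sum>v\<in>S. \<bar>x v\<bar> :: real)"
  using assms
proof (induction Es arbitrary: S)
  case (Cons E Es)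
  have "S \<inter> F = (S - E) \<inter> F" if "F \<in> set Es" for F
    using Cons.prems(1) that prec_irrefl by (fastforce simp: block_less_def)
  then have "(\<Sum>F\<leftarrow>Es. \<Sum>v\<in>S \<inter> F. \<bar>x v\<bar>) = (\<Sum>F\<leftarrow>Es. \<Sum>v\<in>(S - E) \<inter> F. \<bar>x v\<bar>)"
    by (intro arg_cong[where f = sum_list] map_cong) auto
  also have "\<dots> \<le> (\<Sum>v\<in>S - E. \<bar>x v\<bar>)"
    using Cons by simp
  finally show ?case
    using sum.Int_Diff[OF Cons.prems(2), of "\<lambda>v. \<bar>x v\<bar>" E] by simp
qed (simp add: sum_nonneg)

section \<open>Boundedness of the suprema and the seminorm properties\<close>

context
  fixes k d :: nat and \<theta> :: real
  assumes d: "1 \<le> d" and \<theta>_pos: "0 < \<theta>" and \<theta>_less: "\<theta> < 1"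
begin

abbreviation (input) "N \<equiv> T_norm_approx k d \<theta>"

lemma bdd_above_coeffs: "finite_supp x \<Longrightarrow> bdd_above ((\<lambda>v. \<bar>x v\<bar>) ` A)"
proof -
  assume "finite_supp x"
  then have "finite (insert 0 ((\<lambda>v. \<bar>x v\<bar>) ` {v. x v \<noteq> 0}))" by simp
  then show ?thesis by (rule bdd_above_mono[OF bdd_above_finite]) auto
qed

lemma abs_coeff_le_approx_0:
  "finite_supp x \<Longrightarrow> v \<in> nondec k \<Longrightarrow> \<bar>x v\<bar> \<le> N 0 x"
  by (auto intro: cSUP_upper bdd_above_coeffs)

lemma approx_nonneg: "finite_supp x \<Longrightarrow> 0 \<le> N j x"
proof (induction j)
  case 0
  then show ?case
    using abs_coeff_le_approx_0[OF 0 replicate_mem_nondec] by (meson abs_ge_zero order_trans)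
qed (simp add: le_max_iff_disj)

text \<open>The l1 bound, uniform in \<open>j\<close>: disjoint blocks and \<theta> < 1 keep it
  through the recursion. It bounds the suprema over \<open>j\<close> and over admissible families.
  The set \<open>S\<close> may exceed the support, so that the induction can use
  \<open>S \<inter> E\<close> for \<open>restr E x\<close>.\<close>

lemma approx_le_sum:
  assumes "finite S" "\<And>v. v \<notin> S \<Longrightarrow> x v = 0"
  shows "N j x \<le> (\<Sum>v\<in>S. \<bar>x v\<bar>)"
  using assms
proof (induction j arbitrary: S x)
  case 0
  have "\<bar>x v\<bar> \<le> (\<Sum>v\<in>S. \<bar>x v\<bar>)" for v
  proof (cases "v \<in> S")
    case True
    then show ?thesis using 0 by (intro member_le_sum) auto
  qed (simp add: 0 sum_nonneg)
  then show ?case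
    using replicate_mem_nondec by (auto intro!: cSUP_least)
next
  case (Suc j)
  let ?B = "\<Sum>v\<in>S. \<bar>x v\<bar>"
  have "(\<Sum>E\<leftarrow>Es. N j (restr E x)) \<le> ?B" if "admissible k d Es" for Es
  proof -
    have "(\<Sum>E\<leftarrow>Es. N j (restr E x)) \<le> (\<Sum>E\<leftarrow>Es. \<Sum>v\<in>S \<inter> E. \<bar>x v\<bar>)"
    proof (rule sum_list_mono)
      fix E
      have "N j (restr E x) \<le> (\<Sum>v\<in>S \<inter> E. \<bar>restr E x v\<bar>)"
        using Suc.prems by (intro Suc.IH) (auto simp: restr_def)
      then show "N j (restr E x) \<le> (\<Sum>v\<in>S \<inter> E. \<bar>x v\<bar>)" by (simp add: restr_def)
    qed
    also have "\<dots> \<le> ?B"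
      using that Suc.prems by (intro sum_list_block_le) (auto simp: admissible_def)
    finally show ?thesis .
  qed
  then have "(SUP Es\<in>{Es. admissible k d Es}. \<Sum>E\<leftarrow>Es. N j (restr E x)) \<le> ?B"
    using ex_admissible[OF d] by (intro cSUP_least) auto
  then have "\<theta> * (SUP Es\<in>{Es. admissible k d Es}. \<Sum>E\<leftarrow>Es. N j (restr E x)) \<le> \<theta> * ?B"
    using \<theta>_pos by simp
  also have "\<dots> \<le> ?B"
    using \<theta>_less by (intro mult_left_le_one_le) (auto intro: sum_nonneg simp: \<theta>_pos less_imp_le)
  finally show ?case using Suc by simp
qed

lemma approx_le_l1: "finite_supp x \<Longrightarrow> N j x \<le> (\<Sum>v | x v \<noteq> 0. \<bar>x v\<bar>)"
  by (rule approx_le_sum) auto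

lemma approx_zero: "N j (\<lambda>v. 0) = 0"
  using approx_nonneg[of "\<lambda>v. 0" j] approx_le_sum[of "{}" "\<lambda>v. 0" j] by simp

lemma bdd_above_admissible_sums:
  assumes "finite_supp x"
  shows "bdd_above ((\<lambda>Es. \<Sum>E\<leftarrow>Es. N j (restr E x)) ` {Es. admissible k d Es})"
proof (rule bdd_aboveI2)
  fix Es assume Es: "Es \<in> {Es. admissible k d Es}"
  have "(\<Sum>E\<leftarrow>Es. N j (restr E x)) \<le> (\<Sum>E\<leftarrow>Es. \<Sum>v\<in>{v. x v \<noteq> 0} \<inter> E. \<bar>restr E x v\<bar>)"
    using assms by (intro sum_list_mono approx_le_sum) (auto simp: restr_def)
  also have "\<dots> = (\<Sum>E\<leftarrow>Es. \<Sum>v\<in>{v. x v \<noteq> 0} \<inter> E. \<bar>x v\<bar>)"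
    by (simp add: restr_def)
  also have "\<dots> \<le> (\<Sum>v | x v \<noteq> 0. \<bar>x v\<bar>)"
    using Es assms by (intro sum_list_block_le) (auto simp: admissible_def)
  finally show "(\<Sum>E\<leftarrow>Es. N j (restr E x)) \<le> (\<Sum>v | x v \<noteq> 0. \<bar>x v\<bar>)" .
qed

lemma admissible_sum_le_SUP:
  assumes "finite_supp x" "admissible k d Es"
  shows "(\<Sum>E\<leftarrow>Es. N j (restr E x)) \<le>
    (SUP Es\<in>{Es. admissible k d Es}. \<Sum>E\<leftarrow>Es. N j (restr E x))"
  using bdd_above_admissible_sums[OF assms(1)] assms(2) by (auto intro!: cSUP_upper)

text \<open>Together with \<open>admissible_sum_le_approx_Suc\<close> this describes level
  \<open>Suc j\<close> by inequalities for single families, so that later inductions need not handle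
  the supremum.\<close>

lemma approx_Suc_leI:
  assumes "N j x \<le> b"
    and "\<And>Es. admissible k d Es \<Longrightarrow> \<theta> * (\<Sum>E\<leftarrow>Es. N j (restr E x)) \<le> b"
  shows "N (Suc j) x \<le> b"
proof -
  have "(SUP Es\<in>{Es. admissible k d Es}. \<Sum>E\<leftarrow>Es. N j (restr E x)) \<le> b / \<theta>"
    using ex_admissible[OF d] assms(2) \<theta>_pos
    by (intro cSUP_least) (auto simp: field_simps)
  then show ?thesis using assms(1) \<theta>_pos by (simp add: field_simps)
qed

lemma approx_le_Suc: "N j x \<le> N (Suc j) x"
  by simp

lemma admissible_sum_le_approx_Suc:
  assumes "finite_supp x" "admissible k d Es"
  shows "\<theta> * (\<Sum>E\<leftarrow>Es. N j (restr E x)) \<le> N (Suc j) x"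
  using admissible_sum_le_SUP[OF assms, of j] \<theta>_pos by (simp add: le_max_iff_disj)

lemma approx_triangle:
  "finite_supp x \<Longrightarrow> finite_supp y \<Longrightarrow> N j (\<lambda>v. x v + y v) \<le> N j x + N j y"
proof (induction j arbitrary: x y)
  case 0
  have "\<bar>x v + y v\<bar> \<le> N 0 x + N 0 y" if "v \<in> nondec k" for v
    using abs_coeff_le_approx_0[OF 0(1) that] abs_coeff_le_approx_0[OF 0(2) that] by linarith
  then show ?case
    unfolding T_norm_approx.simps(1)[of k d \<theta> "\<lambda>v. x v + y v"]
    using replicate_mem_nondec by (intro cSUP_least) auto
next
  case (Suc j)
  show ?case
  proof (rule approx_Suc_leI)
    show "N j (\<lambda>v. x v + y v) \<le> N (Suc j) x + N (Suc j) y"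
      using Suc.IH[OF Suc.prems] approx_le_Suc[of j x] approx_le_Suc[of j y] by linarith
    fix Es assume Es: "admissible k d Es"
    have "(\<Sum>E\<leftarrow>Es. N j (restr E (\<lambda>v. x v + y v))) \<le> (\<Sum>E\<leftarrow>Es. N j (restr E x) + N j (restr E y))"
      unfolding restr_add using Suc.prems
      by (intro sum_list_mono Suc.IH finite_supp_restr)
    then have "\<theta> * (\<Sum>E\<leftarrow>Es. N j (restr E (\<lambda>v. x v + y v))) \<le>
        \<theta> * (\<Sum>E\<leftarrow>Es. N j (restr E x)) + \<theta> * (\<Sum>E\<leftarrow>Es. N j (restr E y))"
      using \<theta>_pos by (simp add: sum_list_addf flip: distrib_left)
    with admissible_sum_le_approx_Suc[OF Suc.prems(1) Es, of j]
      admissible_sum_le_approx_Suc[OF Suc.prems(2) Es, of j]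
    show "\<theta> * (\<Sum>E\<leftarrow>Es. N j (restr E (\<lambda>v. x v + y v))) \<le> N (Suc j) x + N (Suc j) y"
      by linarith
  qed
qed

lemma approx_scale_le:
  "finite_supp x \<Longrightarrow> N j (\<lambda>v. c * x v) \<le> \<bar>c\<bar> * N j x"
proof (induction j arbitrary: x)
  case 0
  have "\<bar>c * x v\<bar> \<le> \<bar>c\<bar> * N 0 x" if "v \<in> nondec k" for v
    using abs_coeff_le_approx_0[OF 0 that] by (simp add: abs_mult mult_left_mono)
  then show ?case
    unfolding T_norm_approx.simps(1)[of k d \<theta> "\<lambda>v. c * x v"]
    using replicate_mem_nondec by (intro cSUP_least) auto
next
  case (Suc j)
  show ?case
  proof (rule approx_Suc_leI)
    show "N j (\<lambda>v. c * x v) \<le> \<bar>c\<bar> * N (Suc j) x"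
      using Suc.IH[OF Suc.prems] mult_left_mono[OF approx_le_Suc[of j x], of "\<bar>c\<bar>"] by linarith
    fix Es assume Es: "admissible k d Es"
    have "(\<Sum>E\<leftarrow>Es. N j (restr E (\<lambda>v. c * x v))) \<le> (\<Sum>E\<leftarrow>Es. \<bar>c\<bar> * N j (restr E x))"
      unfolding restr_scale using Suc.prems
      by (intro sum_list_mono Suc.IH finite_supp_restr)
    then have "\<theta> * (\<Sum>E\<leftarrow>Es. N j (restr E (\<lambda>v. c * x v))) \<le> \<bar>c\<bar> * (\<theta> * (\<Sum>E\<leftarrow>Es. N j (restr E x)))"
      using \<theta>_pos by (simp add: sum_list_const_mult mult.left_commute)
    also have "\<dots> \<le> \<bar>c\<bar> * N (Suc j) x"
      using admissible_sum_le_approx_Suc[OF Suc.prems Es, of j] by (rule mult_left_mono) simp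
    finally show "\<theta> * (\<Sum>E\<leftarrow>Es. N j (restr E (\<lambda>v. c * x v))) \<le> \<bar>c\<bar> * N (Suc j) x" .
  qed
qed

lemma approx_le_T_norm: "finite_supp x \<Longrightarrow> N j x \<le> T_norm k d \<theta> x"
  unfolding T_norm_def by (intro cSUP_upper bdd_aboveI2[OF approx_le_l1]) auto

lemma T_norm_leI: "(\<And>j. N j x \<le> b) \<Longrightarrow> T_norm k d \<theta> x \<le> b"
  unfolding T_norm_def by (intro cSUP_least) auto

lemma T_norm_triangle:
  assumes "finite_supp x" "finite_supp y"
  shows "T_norm k d \<theta> (\<lambda>v. x v + y v) \<le> T_norm k d \<theta> x + T_norm k d \<theta> y"
proof (rule T_norm_leI)
  fix j
  show "N j (\<lambda>v. x v + y v) \<le> T_norm k d \<theta> x + T_norm k d \<theta> y"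
    using approx_triangle[OF assms, of j] approx_le_T_norm[OF assms(1), of j]
      approx_le_T_norm[OF assms(2), of j] by linarith
qed

lemma T_norm_scale_le:
  assumes "finite_supp x"
  shows "T_norm k d \<theta> (\<lambda>v. c * x v) \<le> \<bar>c\<bar> * T_norm k d \<theta> x"
proof (rule T_norm_leI)
  fix j
  show "N j (\<lambda>v. c * x v) \<le> \<bar>c\<bar> * T_norm k d \<theta> x"
    using approx_scale_le[OF assms, of j c] mult_left_mono[OF approx_le_T_norm[OF assms, of j], of "\<bar>c\<bar>"]
    by linarith
qed

text \<open>The missing inequality is the proved one applied to the scaled vector and the factor
  \<open>1 / c\<close>.\<close>

lemma T_norm_scale:
  assumes "finite_supp x"
  shows "T_norm k d \<theta> (\<lambda>v. c * x v) = \<bar>c\<bar> * T_norm k d \<theta> x"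
proof (cases "c = 0")
  case True
  then show ?thesis by (simp add: T_norm_def approx_zero)
next
  case False
  have "T_norm k d \<theta> x \<le> \<bar>1 / c\<bar> * T_norm k d \<theta> (\<lambda>v. c * x v)"
    using T_norm_scale_le[OF finite_supp_scale[OF assms, of c], of "1 / c"] False by simp
  then have "\<bar>c\<bar> * T_norm k d \<theta> x \<le> T_norm k d \<theta> (\<lambda>v. c * x v)"
    using False by (simp add: field_simps)
  with T_norm_scale_le[OF assms, of c] show ?thesis by linarith
qed

end

section \<open>The action of \<Phi> on vectors and the equality of norms\<close>

lemma Phi_vec_eq:
  assumes "finite_supp x"
  shows "Phi_vec x w = (if w \<in> range Phi then x (tl w) else 0)"
proof -
  have "Phi_vec x w = (\<Sum>v | x v \<noteq> 0. if w = Phi v then x v else 0)"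
    unfolding Phi_vec_def unit_vec_def by (rule sum.cong) auto
  \<comment> \<open>\<Phi> is injective, so at most one summand survives, at
    \<open>v = tl w\<close>; finite support makes the sum a genuine one.\<close>
  also have "\<dots> = (if w \<in> range Phi then x (tl w) else 0)"
  proof (cases "w \<in> range Phi")
    case True
    then have "w = Phi v \<longleftrightarrow> v = tl w" for v by (auto simp: Phi_def)
    then show ?thesis using assms True by (simp add: sum.delta)
  next
    case False
    then show ?thesis by (auto intro!: sum.neutral)
  qed
  finally show ?thesis .
qed

lemma Phi_vec_Phi: "finite_supp x \<Longrightarrow> Phi_vec x (Phi v) = x v"
  by (simp add: Phi_vec_eq) (simp add: Phi_def)

lemma finite_supp_Phi_vec:
  assumes "finite_supp x"
  shows "finite_supp (Phi_vec x)"
proof (rule finite_subset)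
  show "{w. Phi_vec x w \<noteq> 0} \<subseteq> Phi ` {v. x v \<noteq> 0}"
    using assms by (auto simp: Phi_vec_eq Phi_def)
qed (use assms in simp)

text \<open>A block sees the image vector only through its \<Phi>-preimage; hence points added
  outside the range of \<Phi> cost nothing.\<close>

lemma restr_Phi_vec:
  assumes "finite_supp x"
  shows "restr E (Phi_vec x) = Phi_vec (restr (Phi -` E) x)"
proof
  fix w
  show "restr E (Phi_vec x) w = Phi_vec (restr (Phi -` E) x) w"
    unfolding Phi_vec_eq[OF finite_supp_restr[OF assms]]
    by (auto simp: restr_def Phi_vec_eq[OF assms] Phi_def)
qed

text \<open>Families one level up are pulled back for the upper estimate, and families at level
  \<open>k\<close> are lifted for the lower one. The vector is arbitrary in the induction because
  the recursion passes to restrictions.\<close>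

lemma approx_Phi_vec:
  assumes k: "1 \<le> k" and d: "1 \<le> d" and \<theta>: "0 < \<theta>" "\<theta> < 1"
  shows "finite_supp x \<Longrightarrow> T_norm_approx (k + 1) d \<theta> j (Phi_vec x) = T_norm_approx k d \<theta> j x"
proof (induction j arbitrary: x)
  case 0
  note fin = 0 finite_supp_Phi_vec[OF 0]
  show ?case
  proof (rule antisym)
    have "\<bar>Phi_vec x w\<bar> \<le> T_norm_approx k d \<theta> 0 x" if w: "w \<in> nondec (k + 1)" for w
    proof (cases "w \<in> range Phi")
      case True
      then obtain v where v: "w = Phi v" by blast
      with w have "v \<in> nondec k" using Phi_mem_nondec_iff by blast
      then show ?thesis
        using abs_coeff_le_approx_0[OF d \<theta> fin(1)] by (simp add: v Phi_vec_Phi 0 del: T_norm_approx.simps)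
    next
      case False
      then show ?thesis using approx_nonneg[OF d \<theta> fin(1), of k 0] by (simp add: Phi_vec_eq 0 del: T_norm_approx.simps)
    qed
    then show "T_norm_approx (k + 1) d \<theta> 0 (Phi_vec x) \<le> T_norm_approx k d \<theta> 0 x"
      unfolding T_norm_approx.simps(1)[of "k + 1"] using replicate_mem_nondec
      by (intro cSUP_least) blast+
    have "\<bar>x v\<bar> \<le> T_norm_approx (k + 1) d \<theta> 0 (Phi_vec x)" if v: "v \<in> nondec k" for v
      using abs_coeff_le_approx_0[OF d \<theta> fin(2), of "Phi v" "k + 1"] v Phi_mem_nondec_iff[of v k]
      by (simp add: Phi_vec_Phi 0 del: T_norm_approx.simps)
    then show "T_norm_approx k d \<theta> 0 x \<le> T_norm_approx (k + 1) d \<theta> 0 (Phi_vec x)"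
      unfolding T_norm_approx.simps(1)[of k] using replicate_mem_nondec
      by (intro cSUP_least) blast+
  qed
next
  case (Suc j)
  note fin = Suc.prems finite_supp_Phi_vec[OF Suc.prems]
  have sum_eq: "(\<Sum>E\<leftarrow>Es. T_norm_approx (k + 1) d \<theta> j (restr E (Phi_vec x))) =
      (\<Sum>E\<leftarrow>map ((-`) Phi) Es. T_norm_approx k d \<theta> j (restr E x))" for Es
    using Suc.IH[OF finite_supp_restr[OF fin(1)]] by (simp add: restr_Phi_vec fin(1) comp_def)
  show ?case
  proof (rule antisym)
    show "T_norm_approx (k + 1) d \<theta> (Suc j) (Phi_vec x) \<le> T_norm_approx k d \<theta> (Suc j) x"
    proof (rule approx_Suc_leI[OF d \<theta>])
      show "T_norm_approx (k + 1) d \<theta> j (Phi_vec x) \<le> T_norm_approx k d \<theta> (Suc j) x"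
        unfolding Suc.IH[OF fin(1)] by simp
      fix Es assume Es: "admissible (k + 1) d Es"
      define Es' where "Es' = filter (\<lambda>E. E \<noteq> {}) (map ((-`) Phi) Es)"
      \<comment> \<open>Blocks that miss the range of \<Phi> contribute 0, so dropping them leaves
        the sum unchanged.\<close>
      have "restr {} x = (\<lambda>v. 0)" by (simp add: restr_def)
      then have "(\<Sum>E\<leftarrow>map ((-`) Phi) Es. T_norm_approx k d \<theta> j (restr E x)) =
          (\<Sum>E\<leftarrow>Es'. T_norm_approx k d \<theta> j (restr E x))"
        unfolding Es'_def by (intro sum_list_map_filter[symmetric]) (auto simp: approx_zero[OF d \<theta>])
      moreover have "\<theta> * (\<Sum>E\<leftarrow>Es'. T_norm_approx k d \<theta> j (restr E x)) \<le> T_norm_approx k d \<theta> (Suc j) x"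
      \<comment> \<open>\<open>admissible\<close> excludes the empty family, so the case that no
        block meets the range of \<Phi> is separate.\<close>
      proof (cases "Es' = []")
        case True
        then show ?thesis using approx_nonneg[OF d \<theta> fin(1), of k "Suc j"] by simp
      next
        case False
        then have "admissible k d Es'" using admissible_vimage_Phi[OF Es] by (simp add: Es'_def)
        then show ?thesis by (rule admissible_sum_le_approx_Suc[OF d \<theta> fin(1)])
      qed
      ultimately show "\<theta> * (\<Sum>E\<leftarrow>Es. T_norm_approx (k + 1) d \<theta> j (restr E (Phi_vec x)))
          \<le> T_norm_approx k d \<theta> (Suc j) x"
        by (simp only: sum_eq)
    qed
    show "T_norm_approx k d \<theta> (Suc j) x \<le> T_norm_approx (k + 1) d \<theta> (Suc j) (Phi_vec x)"
    proof (rule approx_Suc_leI[OF d \<theta>])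
      show "T_norm_approx k d \<theta> j x \<le> T_norm_approx (k + 1) d \<theta> (Suc j) (Phi_vec x)"
        unfolding Suc.IH[OF fin(1), symmetric] by simp
      fix Es assume "admissible k d Es"
      then obtain Es' where Es': "admissible (k + 1) d Es'" "map ((-`) Phi) Es' = Es"
        using admissible_lift k by blast
      show "\<theta> * (\<Sum>E\<leftarrow>Es. T_norm_approx k d \<theta> j (restr E x))
          \<le> T_norm_approx (k + 1) d \<theta> (Suc j) (Phi_vec x)"
        using admissible_sum_le_approx_Suc[OF d \<theta> fin(2) Es'(1), of j] unfolding sum_eq Es'(2) .
    qed
  qed
qed

section \<open>Completions of seminormed spaces\<close>

text \<open>The record has no zero vector; \<open>scale V 0 y\<close> stands for it, for any point
  \<open>y\<close>. Points at distance 0 are identified only by \<open>cauchy_equiv\<close>, so the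
  laws are those of a seminorm.\<close>

locale seminormed_space =
  fixes V :: "'a nspace"
  assumes add_closed: "x \<in> pts V \<Longrightarrow> y \<in> pts V \<Longrightarrow> add V x y \<in> pts V"
    and scale_closed: "x \<in> pts V \<Longrightarrow> scale V c x \<in> pts V"
    and add_commute: "x \<in> pts V \<Longrightarrow> y \<in> pts V \<Longrightarrow> add V x y = add V y x"
    and add_assoc: "x \<in> pts V \<Longrightarrow> y \<in> pts V \<Longrightarrow> z \<in> pts V \<Longrightarrow>
      add V (add V x y) z = add V x (add V y z)"
    and scale_add: "x \<in> pts V \<Longrightarrow> y \<in> pts V \<Longrightarrow>
      scale V c (add V x y) = add V (scale V c x) (scale V c y)"
    and add_scale: "x \<in> pts V \<Longrightarrow> add V (scale V a x) (scale V b x) = scale V (a + b) x"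
    and scale_scale: "x \<in> pts V \<Longrightarrow> scale V a (scale V b x) = scale V (a * b) x"
    and scale_one: "x \<in> pts V \<Longrightarrow> scale V 1 x = x"
    and add_scale_zero: "x \<in> pts V \<Longrightarrow> y \<in> pts V \<Longrightarrow> add V x (scale V 0 y) = x"
    and nrm_triangle: "x \<in> pts V \<Longrightarrow> y \<in> pts V \<Longrightarrow> nrm V (add V x y) \<le> nrm V x + nrm V y"
    and nrm_scale: "x \<in> pts V \<Longrightarrow> nrm V (scale V c x) = \<bar>c\<bar> * nrm V x"
begin

lemma add_add_swap:
  assumes "x \<in> pts V" "y \<in> pts V" "z \<in> pts V" "w \<in> pts V"
  shows "add V (add V x y) (add V z w) = add V (add V x z) (add V y w)"
proof -
  have "add V y (add V z w) = add V z (add V y w)"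
    using assms by (metis add_assoc add_commute)
  then show ?thesis using assms by (simp add: add_assoc add_closed)
qed

lemma ndist_self: "x \<in> pts V \<Longrightarrow> ndist V x x = 0"
  using add_scale[of x 1 "- 1"] nrm_scale[of x 0] by (simp add: ndist_def scale_one)

lemma ndist_commute:
  assumes "x \<in> pts V" "y \<in> pts V"
  shows "ndist V x y = ndist V y x"
proof -
  have "scale V (- 1) (add V x (scale V (- 1) y)) = add V y (scale V (- 1) x)"
    using assms by (simp add: scale_add scale_closed scale_scale scale_one add_commute)
  then show ?thesis
    using nrm_scale[of "add V x (scale V (- 1) y)" "- 1"] assms
    by (simp add: ndist_def add_closed scale_closed)
qed

text \<open>Telescoping: a negated \<open>z\<close> gives the triangle inequality for
  \<open>ndist\<close>, and \<open>scale V 0 y\<close> as \<open>z\<close> writes \<open>x\<close>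
  as (x - y) + y.\<close>

lemma add_diff_cancel:
  assumes "x \<in> pts V" "y \<in> pts V" "z \<in> pts V"
  shows "add V (add V x (scale V (- 1) y)) (add V y z) = add V x z"
proof -
  have "add V (add V x (scale V (- 1) y)) (add V y z) =
      add V (add V x (scale V (- 1) y)) (add V z y)"
    using assms by (simp add: add_commute)
  also have "\<dots> = add V (add V x z) (add V (scale V (- 1) y) (scale V 1 y))"
    using assms by (simp add: add_add_swap scale_closed scale_one)
  also have "\<dots> = add V x z"
    unfolding add_scale[OF assms(2)] using assms by (simp add: add_scale_zero add_closed)
  finally show ?thesis .
qed

lemma ndist_triangle:
  assumes "x \<in> pts V" "y \<in> pts V" "z \<in> pts V"
  shows "ndist V x z \<le> ndist V x y + ndist V y z"
  using nrm_triangle[of "add V x (scale V (- 1) y)" "add V y (scale V (- 1) z)"] assms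
  by (simp add: ndist_def add_closed scale_closed add_diff_cancel)

text \<open>The seminorm of x - x is 0 and at most twice that of x.\<close>

lemma nrm_nonneg: "x \<in> pts V \<Longrightarrow> 0 \<le> nrm V x"
  using nrm_triangle[of x "scale V (- 1) x"] nrm_scale[of x "- 1"] ndist_self[of x]
  by (simp add: ndist_def scale_closed)

lemma ndist_nonneg: "x \<in> pts V \<Longrightarrow> y \<in> pts V \<Longrightarrow> 0 \<le> ndist V x y"
  by (simp add: ndist_def nrm_nonneg add_closed scale_closed)

lemma ndist_add_le:
  assumes "x \<in> pts V" "y \<in> pts V" "x' \<in> pts V" "y' \<in> pts V"
  shows "ndist V (add V x y) (add V x' y') \<le> ndist V x x' + ndist V y y'"
  using nrm_triangle[of "add V x (scale V (- 1) x')" "add V y (scale V (- 1) y')"] assms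
  by (simp add: ndist_def add_closed scale_closed scale_add add_add_swap)

lemma ndist_scale:
  assumes "x \<in> pts V" "y \<in> pts V"
  shows "ndist V (scale V c x) (scale V c y) = \<bar>c\<bar> * ndist V x y"
  using nrm_scale[of "add V x (scale V (- 1) y)" c] assms
  by (simp add: ndist_def add_closed scale_closed scale_add scale_scale)

lemma abs_nrm_diff_le:
  assumes "x \<in> pts V" "y \<in> pts V"
  shows "\<bar>nrm V x - nrm V y\<bar> \<le> ndist V x y"
proof -
  have "nrm V x \<le> ndist V x y + nrm V y" if "x \<in> pts V" "y \<in> pts V" for x y
  proof -
    have "add V (add V x (scale V (- 1) y)) y = x"
      using add_diff_cancel[of x y "scale V 0 y"] that by (simp add: add_scale_zero scale_closed)
    then show ?thesis
      using nrm_triangle[of "add V x (scale V (- 1) y)" y] that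
      by (simp add: ndist_def add_closed scale_closed)
  qed
  from this[OF assms] this[OF assms(2,1)] ndist_commute[OF assms] show ?thesis by linarith
qed

lemma cauchy_seqs_pts: "X \<in> cauchy_seqs V \<Longrightarrow> X n \<in> pts V"
  by (simp add: cauchy_seqs_def)

lemma cauchy_seqsE:
  assumes "X \<in> cauchy_seqs V" "e > 0"
  obtains N where "\<And>m n. m \<ge> N \<Longrightarrow> n \<ge> N \<Longrightarrow> ndist V (X m) (X n) < e"
  using assms unfolding cauchy_seqs_def by blast

lemma equiv_cauchy_equiv: "equiv (cauchy_seqs V) (cauchy_equiv V)"
proof (rule equivI)
  show "cauchy_equiv V \<subseteq> cauchy_seqs V \<times> cauchy_seqs V"
    by (auto simp: cauchy_equiv_def)
  show "refl_on (cauchy_seqs V) (cauchy_equiv V)"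
    by (auto simp: refl_on_def cauchy_equiv_def ndist_self cauchy_seqs_pts)
  show "sym (cauchy_equiv V)"
  proof (rule symI)
    fix X Y assume "(X, Y) \<in> cauchy_equiv V"
    then show "(Y, X) \<in> cauchy_equiv V"
      by (simp add: cauchy_equiv_def ndist_commute cauchy_seqs_pts)
  qed
  show "trans (cauchy_equiv V)"
  proof (rule transI)
    fix X Y Z assume "(X, Y) \<in> cauchy_equiv V" "(Y, Z) \<in> cauchy_equiv V"
    then have mem: "X \<in> cauchy_seqs V" "Y \<in> cauchy_seqs V" "Z \<in> cauchy_seqs V"
      and XY: "(\<lambda>n. ndist V (X n) (Y n)) \<longlonglongrightarrow> 0" and YZ: "(\<lambda>n. ndist V (Y n) (Z n)) \<longlonglongrightarrow> 0"
      by (auto simp: cauchy_equiv_def)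
    have lim: "(\<lambda>n. ndist V (X n) (Y n) + ndist V (Y n) (Z n)) \<longlonglongrightarrow> 0"
      using tendsto_add[OF XY YZ] by simp
    have "(\<lambda>n. ndist V (X n) (Z n)) \<longlonglongrightarrow> 0"
      by (rule tendsto_sandwich[OF _ _ tendsto_const lim])
        (auto simp: ndist_nonneg cauchy_seqs_pts mem intro!: always_eventually ndist_triangle)
    with mem show "(X, Z) \<in> cauchy_equiv V" by (simp add: cauchy_equiv_def)
  qed
qed

lemma cauchy_seqs_add:
  assumes X: "X \<in> cauchy_seqs V" and Y: "Y \<in> cauchy_seqs V"
  shows "(\<lambda>n. add V (X n) (Y n)) \<in> cauchy_seqs V"
  unfolding cauchy_seqs_def
proof safe
  fix n show "add V (X n) (Y n) \<in> pts V"
    using X Y by (simp add: add_closed cauchy_seqs_pts)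
next
  fix e :: real assume "e > 0"
  then have "e / 2 > 0" by simp
  then obtain M N where
    M: "\<And>m n. m \<ge> M \<Longrightarrow> n \<ge> M \<Longrightarrow> ndist V (X m) (X n) < e / 2" and
    N: "\<And>m n. m \<ge> N \<Longrightarrow> n \<ge> N \<Longrightarrow> ndist V (Y m) (Y n) < e / 2"
    using cauchy_seqsE[OF X] cauchy_seqsE[OF Y] by metis
  have "ndist V (add V (X m) (Y m)) (add V (X n) (Y n)) < e" if "m \<ge> max M N" "n \<ge> max M N" for m n
    using M[of m n] N[of m n] that
      ndist_add_le[of "X m" "Y m" "X n" "Y n"] cauchy_seqs_pts[OF X] cauchy_seqs_pts[OF Y] by simp
  then show "\<exists>N. \<forall>m\<ge>N. \<forall>n\<ge>N. ndist V (add V (X m) (Y m)) (add V (X n) (Y n)) < e" by blast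
qed

lemma cauchy_seqs_scale:
  assumes X: "X \<in> cauchy_seqs V"
  shows "(\<lambda>n. scale V c (X n)) \<in> cauchy_seqs V"
  unfolding cauchy_seqs_def
proof safe
  fix n show "scale V c (X n) \<in> pts V"
    using X by (simp add: scale_closed cauchy_seqs_pts)
next
  fix e :: real assume "e > 0"
  \<comment> \<open>The summand 1 keeps the divisor positive when \<open>c = 0\<close>.\<close>
  then have "e / (\<bar>c\<bar> + 1) > 0" by simp
  then obtain N where N: "\<And>m n. m \<ge> N \<Longrightarrow> n \<ge> N \<Longrightarrow> ndist V (X m) (X n) < e / (\<bar>c\<bar> + 1)"
    using cauchy_seqsE[OF X] by blast
  have "ndist V (scale V c (X m)) (scale V c (X n)) < e" if "m \<ge> N" "n \<ge> N" for m n
  proof -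
    have "\<bar>c\<bar> * ndist V (X m) (X n) \<le> (\<bar>c\<bar> + 1) * ndist V (X m) (X n)"
      using X by (intro mult_right_mono) (auto simp: ndist_nonneg cauchy_seqs_pts)
    also have "\<dots> < e"
      using N[OF that] by (simp add: pos_less_divide_eq mult.commute)
    finally show ?thesis using X by (simp add: ndist_scale cauchy_seqs_pts)
  qed
  then show "\<exists>N. \<forall>m\<ge>N. \<forall>n\<ge>N. ndist V (scale V c (X m)) (scale V c (X n)) < e" by blast
qed

abbreviation cls :: "(nat \<Rightarrow> 'a) \<Rightarrow> (nat \<Rightarrow> 'a) set" where
  "cls X \<equiv> cauchy_equiv V `` {X}"

lemma cls_eq_iff:
  "X \<in> cauchy_seqs V \<Longrightarrow> Y \<in> cauchy_seqs V \<Longrightarrow> cls X = cls Y \<longleftrightarrow> (X, Y) \<in> cauchy_equiv V"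
  using equiv_cauchy_equiv by (simp add: eq_equiv_class_iff)

lemma cls_self: "X \<in> cauchy_seqs V \<Longrightarrow> X \<in> cls X"
  using equiv_cauchy_equiv by (rule equiv_class_self)

lemma cauchy_equivD:
  assumes "(X, Y) \<in> cauchy_equiv V"
  shows "X \<in> cauchy_seqs V" "Y \<in> cauchy_seqs V" "(\<lambda>n. ndist V (X n) (Y n)) \<longlonglongrightarrow> 0"
  using assms by (auto simp: cauchy_equiv_def)

lemma UN_cls:
  assumes "X \<in> cauchy_seqs V" "\<And>Y. (X, Y) \<in> cauchy_equiv V \<Longrightarrow> G Y = G X"
  shows "(\<Union>Y\<in>cls X. G Y) = G X"
  using assms cls_self by blast

text \<open>Changing representatives by null sequences changes the termwise sum by a null sequence,
  so the union collapses to one class.\<close>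

lemma completion_add_cls:
  assumes X: "X \<in> cauchy_seqs V" and Y: "Y \<in> cauchy_seqs V"
  shows "add (completion V) (cls X) (cls Y) = cls (\<lambda>n. add V (X n) (Y n))"
proof -
  have "cls (\<lambda>n. add V (X' n) (Y' n)) = cls (\<lambda>n. add V (X n) (Y n))"
    if XX: "(X, X') \<in> cauchy_equiv V" and YY: "(Y, Y') \<in> cauchy_equiv V" for X' Y'
  proof -
    note X' = cauchy_equivD(2)[OF XX] and Y' = cauchy_equivD(2)[OF YY]
    have lim: "(\<lambda>n. ndist V (X n) (X' n) + ndist V (Y n) (Y' n)) \<longlonglongrightarrow> 0"
      using tendsto_add[OF cauchy_equivD(3)[OF XX] cauchy_equivD(3)[OF YY]] by simp
    have "(\<lambda>n. ndist V (add V (X n) (Y n)) (add V (X' n) (Y' n))) \<longlonglongrightarrow> 0"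
      using X Y X' Y'
      by (intro tendsto_sandwich[OF _ _ tendsto_const lim])
        (auto simp: ndist_nonneg add_closed cauchy_seqs_pts intro!: always_eventually ndist_add_le)
    then have "(\<lambda>n. add V (X n) (Y n), \<lambda>n. add V (X' n) (Y' n)) \<in> cauchy_equiv V"
      using X Y X' Y' by (simp add: cauchy_equiv_def cauchy_seqs_add)
    from equiv_class_eq[OF equiv_cauchy_equiv this] show ?thesis by (rule sym)
  qed
  then have "(\<Union>X'\<in>cls X. \<Union>Y'\<in>cls Y. cls (\<lambda>n. add V (X' n) (Y' n))) = cls (\<lambda>n. add V (X n) (Y n))"
    using cls_self[OF X] cls_self[OF Y] by blast
  then show ?thesis by (simp only: completion_def nspace.simps)
qed

lemma completion_scale_cls:
  assumes X: "X \<in> cauchy_seqs V"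
  shows "scale (completion V) c (cls X) = cls (\<lambda>n. scale V c (X n))"
proof -
  have "cls (\<lambda>n. scale V c (X' n)) = cls (\<lambda>n. scale V c (X n))"
    if XX: "(X, X') \<in> cauchy_equiv V" for X'
  proof -
    note X' = cauchy_equivD(2)[OF XX]
    have "(\<lambda>n. \<bar>c\<bar> * ndist V (X n) (X' n)) \<longlonglongrightarrow> 0"
      using tendsto_mult_right_zero[OF cauchy_equivD(3)[OF XX]] .
    then have "(\<lambda>n. scale V c (X n), \<lambda>n. scale V c (X' n)) \<in> cauchy_equiv V"
      using X X' by (simp add: cauchy_equiv_def cauchy_seqs_scale ndist_scale cauchy_seqs_pts)
    from equiv_class_eq[OF equiv_cauchy_equiv this] show ?thesis by (rule sym)
  qed
  then have "(\<Union>X'\<in>cls X. cls (\<lambda>n. scale V c (X' n))) = cls (\<lambda>n. scale V c (X n))"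
    by (rule UN_cls[OF X])
  then show ?thesis by (simp only: completion_def nspace.simps)
qed

lemma convergent_nrm:
  assumes X: "X \<in> cauchy_seqs V"
  shows "convergent (\<lambda>n. nrm V (X n))"
  unfolding Cauchy_convergent_iff[symmetric]
proof (rule metric_CauchyI)
  fix e :: real assume "e > 0"
  then obtain N where "\<And>m n. m \<ge> N \<Longrightarrow> n \<ge> N \<Longrightarrow> ndist V (X m) (X n) < e"
    using cauchy_seqsE[OF X] by blast
  then show "\<exists>N. \<forall>m\<ge>N. \<forall>n\<ge>N. dist (nrm V (X m)) (nrm V (X n)) < e"
    using abs_nrm_diff_le[OF cauchy_seqs_pts[OF X] cauchy_seqs_pts[OF X]]
    unfolding dist_real_def by (meson order_le_less_trans)
qed

text \<open>The reverse triangle inequality gives the same limit along equivalent sequences, which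
  makes the definite description proper.\<close>

lemma completion_nrm_cls:
  assumes X: "X \<in> cauchy_seqs V"
  shows "nrm (completion V) (cls X) = lim (\<lambda>n. nrm V (X n))"
proof -
  let ?l = "lim (\<lambda>n. nrm V (X n))"
  have l: "(\<lambda>n. nrm V (X n)) \<longlonglongrightarrow> ?l"
    using convergent_nrm[OF X] by (simp add: convergent_LIMSEQ_iff)
  have "(\<lambda>n. nrm V (Y n)) \<longlonglongrightarrow> ?l" if "Y \<in> cls X" for Y
  proof -
    from that have XY: "(X, Y) \<in> cauchy_equiv V" by simp
    have "(\<lambda>n. \<bar>nrm V (X n) - nrm V (Y n)\<bar>) \<longlonglongrightarrow> 0"
      using abs_nrm_diff_le[OF cauchy_seqs_pts[OF X] cauchy_seqs_pts[OF cauchy_equivD(2)[OF XY]]]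
      by (intro tendsto_sandwich[OF _ _ tendsto_const cauchy_equivD(3)[OF XY]]) simp_all
    then have "(\<lambda>n. nrm V (X n) - nrm V (Y n)) \<longlonglongrightarrow> 0"
      by (rule tendsto_rabs_zero_cancel)
    from tendsto_diff[OF l this] show ?thesis by simp
  qed
  then have "(THE r. \<forall>Y\<in>cls X. (\<lambda>n. nrm V (Y n)) \<longlonglongrightarrow> r) = ?l"
    using cls_self[OF X] LIMSEQ_unique by (intro the_equality) blast+
  then show ?thesis by (simp add: completion_def)
qed

lemma pts_completion: "pts (completion V) = cls ` cauchy_seqs V"
  by (auto simp: completion_def quotient_def)

lemma const_mem_cauchy_seqs: "x \<in> pts V \<Longrightarrow> (\<lambda>n. x) \<in> cauchy_seqs V"
  by (simp add: cauchy_seqs_def ndist_self)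

end

text \<open>The extension applies the given map termwise to Cauchy sequences; all operations on
  classes are computed on representatives.\<close>

lemma linear_isometric_embedding_completion:
  assumes "seminormed_space V" "seminormed_space W" and \<phi>: "linear_isometric_embedding V W \<phi>"
  shows "\<exists>F. linear_isometric_embedding (completion V) (completion W) F \<and>
    (\<forall>x\<in>pts V. F (to_completion V x) = to_completion W (\<phi> x))"
proof -
  interpret V: seminormed_space V by fact
  interpret W: seminormed_space W by fact
  have \<phi>_mem: "\<phi> x \<in> pts W" if "x \<in> pts V" for x
    using \<phi> that by (auto simp: linear_isometric_embedding_def)
  have \<phi>_add: "\<phi> (add V x y) = add W (\<phi> x) (\<phi> y)" if "x \<in> pts V" "y \<in> pts V" for x y
    using \<phi> that by (auto simp: linear_isometric_embedding_def)
  have \<phi>_scale: "\<phi> (scale V c x) = scale W c (\<phi> x)" if "x \<in> pts V" for x c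
    using \<phi> that by (auto simp: linear_isometric_embedding_def)
  have \<phi>_nrm: "nrm W (\<phi> x) = nrm V x" if "x \<in> pts V" for x
    using \<phi> that by (auto simp: linear_isometric_embedding_def)
  have \<phi>_ndist: "ndist W (\<phi> x) (\<phi> y) = ndist V x y" if "x \<in> pts V" "y \<in> pts V" for x y
    using that unfolding ndist_def
    by (simp flip: \<phi>_add \<phi>_scale add: \<phi>_nrm V.add_closed V.scale_closed)
  have seq: "(\<lambda>n. \<phi> (X n)) \<in> cauchy_seqs W" if "X \<in> cauchy_seqs V" for X
    using that by (simp add: cauchy_seqs_def \<phi>_mem \<phi>_ndist)
  \<comment> \<open>One direction makes \<open>F\<close> well defined on classes, the other makes it
    injective.\<close>
  have equiv_iff: "(\<lambda>n. \<phi> (X n), \<lambda>n. \<phi> (Y n)) \<in> cauchy_equiv W \<longleftrightarrow> (X, Y) \<in> cauchy_equiv V"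
    if "X \<in> cauchy_seqs V" "Y \<in> cauchy_seqs V" for X Y
    using that by (simp add: cauchy_equiv_def seq \<phi>_ndist V.cauchy_seqs_pts)
  define F where "F A = (\<Union>X\<in>A. W.cls (\<lambda>n. \<phi> (X n)))" for A
  have F: "F (V.cls X) = W.cls (\<lambda>n. \<phi> (X n))" if X: "X \<in> cauchy_seqs V" for X
    unfolding F_def
  proof (rule V.UN_cls[OF X])
    fix Y assume XY: "(X, Y) \<in> cauchy_equiv V"
    note Y = V.cauchy_equivD(2)[OF XY]
    show "W.cls (\<lambda>n. \<phi> (Y n)) = W.cls (\<lambda>n. \<phi> (X n))"
      using equiv_iff[OF X Y] W.cls_eq_iff[OF seq[OF X] seq[OF Y]] XY by simp
  qed
  have "linear_isometric_embedding (completion V) (completion W) F"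
    unfolding linear_isometric_embedding_def V.pts_completion W.pts_completion
  proof (intro conjI ballI allI)
    show "F \<in> V.cls ` cauchy_seqs V \<rightarrow> W.cls ` cauchy_seqs W"
      using F seq by auto
    show "inj_on F (V.cls ` cauchy_seqs V)"
    proof (rule inj_onI)
      fix u v assume "u \<in> V.cls ` cauchy_seqs V" "v \<in> V.cls ` cauchy_seqs V" and eq: "F u = F v"
      then obtain X Y where X: "X \<in> cauchy_seqs V" "u = V.cls X" and Y: "Y \<in> cauchy_seqs V" "v = V.cls Y"
        by blast
      have "(\<lambda>n. \<phi> (X n), \<lambda>n. \<phi> (Y n)) \<in> cauchy_equiv W"
        using eq unfolding X(2) Y(2) F[OF X(1)] F[OF Y(1)] W.cls_eq_iff[OF seq[OF X(1)] seq[OF Y(1)]] .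
      then show "u = v"
        unfolding X(2) Y(2) V.cls_eq_iff[OF X(1) Y(1)] equiv_iff[OF X(1) Y(1)] .
    qed
  next
    fix u v assume "u \<in> V.cls ` cauchy_seqs V" "v \<in> V.cls ` cauchy_seqs V"
    then obtain X Y where X: "X \<in> cauchy_seqs V" "u = V.cls X" and Y: "Y \<in> cauchy_seqs V" "v = V.cls Y"
      by blast
    then show "F (add (completion V) u v) = add (completion W) (F u) (F v)"
      by (simp add: F seq V.completion_add_cls W.completion_add_cls V.cauchy_seqs_add \<phi>_add V.cauchy_seqs_pts)
  next
    fix c u assume "u \<in> V.cls ` cauchy_seqs V"
    then obtain X where "X \<in> cauchy_seqs V" "u = V.cls X" by blast
    then show "F (scale (completion V) c u) = scale (completion W) c (F u)"
      by (simp add: F seq V.completion_scale_cls W.completion_scale_cls V.cauchy_seqs_scale \<phi>_scale V.cauchy_seqs_pts)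
  next
    fix u assume "u \<in> V.cls ` cauchy_seqs V"
    then obtain X where "X \<in> cauchy_seqs V" "u = V.cls X" by blast
    then show "nrm (completion W) (F u) = nrm (completion V) u"
      by (simp add: F seq V.completion_nrm_cls W.completion_nrm_cls \<phi>_nrm V.cauchy_seqs_pts)
  qed
  moreover have "\<forall>x\<in>pts V. F (to_completion V x) = to_completion W (\<phi> x)"
    by (simp add: to_completion_def F V.const_mem_cauchy_seqs)
  ultimately show ?thesis by blast
qed

section \<open>The spaces of finitely supported vectors and the conclusion\<close>

lemma pts_c00: "x \<in> pts (c00 k d \<theta>) \<longleftrightarrow> finite_supp x \<and> (\<forall>v. x v \<noteq> 0 \<longrightarrow> v \<in> nondec k)"
  by (auto simp: c00_def)

lemma seminormed_space_c00:
  assumes "1 \<le> d" "0 < \<theta>" "\<theta> < 1"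
  shows "seminormed_space (c00 k d \<theta>)"
proof
  fix x y and c :: real assume x: "x \<in> pts (c00 k d \<theta>)"
  show "scale (c00 k d \<theta>) c x \<in> pts (c00 k d \<theta>)"
    using x finite_supp_scale[of x c] by (auto simp: pts_c00) (auto simp: c00_def)
  show "nrm (c00 k d \<theta>) (scale (c00 k d \<theta>) c x) = \<bar>c\<bar> * nrm (c00 k d \<theta>) x"
    using x T_norm_scale[OF assms, of x] by (simp add: c00_def)
  assume y: "y \<in> pts (c00 k d \<theta>)"
  show "add (c00 k d \<theta>) x y \<in> pts (c00 k d \<theta>)"
    using x y finite_supp_add[of x y] unfolding pts_c00 by (auto simp: c00_def) (metis add_0)
  show "nrm (c00 k d \<theta>) (add (c00 k d \<theta>) x y) \<le> nrm (c00 k d \<theta>) x + nrm (c00 k d \<theta>) y"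
    using x y T_norm_triangle[OF assms, of x y] by (simp add: c00_def)
qed (auto simp: c00_def algebra_simps)

lemma linear_isometric_embedding_Phi_vec:
  assumes "1 \<le> k" "1 \<le> d" "0 < \<theta>" "\<theta> < 1"
  shows "linear_isometric_embedding (c00 k d \<theta>) (c00 (k + 1) d \<theta>) Phi_vec"
proof -
  have "Phi_vec x \<in> pts (c00 (k + 1) d \<theta>)" if "x \<in> pts (c00 k d \<theta>)" for x
  proof -
    have "w \<in> nondec (k + 1)" if "Phi_vec x w \<noteq> 0" for w
    proof -
      from that \<open>x \<in> _\<close> obtain v where "w = Phi v" "x v \<noteq> 0"
        by (auto simp: pts_c00 Phi_vec_eq Phi_def split: if_splits)
      with \<open>x \<in> _\<close> show ?thesis using Phi_mem_nondec_iff pts_c00 by blast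
    qed
    with that show ?thesis using finite_supp_Phi_vec unfolding pts_c00 by blast
  qed
  moreover have "inj_on Phi_vec (pts (c00 k d \<theta>))"
  proof (rule inj_onI, rule ext)
    fix x y v assume "x \<in> pts (c00 k d \<theta>)" "y \<in> pts (c00 k d \<theta>)" "Phi_vec x = Phi_vec y"
    then show "x v = y v" using Phi_vec_Phi pts_c00 by metis
  qed
  moreover have "Phi_vec (add (c00 k d \<theta>) x y) = add (c00 (k + 1) d \<theta>) (Phi_vec x) (Phi_vec y)"
    if "x \<in> pts (c00 k d \<theta>)" "y \<in> pts (c00 k d \<theta>)" for x y
    using that finite_supp_add[of x y] by (auto simp: c00_def Phi_vec_eq)
  moreover have "Phi_vec (scale (c00 k d \<theta>) c x) = scale (c00 (k + 1) d \<theta>) c (Phi_vec x)"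
    if "x \<in> pts (c00 k d \<theta>)" for c x
    using that finite_supp_scale[of x c] by (auto simp: c00_def Phi_vec_eq)
  \<comment> \<open>Both norms are suprema over \<open>j\<close> of approximations that agree for
    each \<open>j\<close>.\<close>
  moreover have "nrm (c00 (k + 1) d \<theta>) (Phi_vec x) = nrm (c00 k d \<theta>) x" if "x \<in> pts (c00 k d \<theta>)" for x
    using that approx_Phi_vec[OF assms] by (simp add: c00_def T_norm_def)
  ultimately show ?thesis unfolding linear_isometric_embedding_def by blast
qed

theorem theorem8p5:
  fixes k d :: nat and \<theta> :: real
  assumes "1 \<le> k" and "1 \<le> d" and "0 < \<theta>" and "\<theta> < 1" and "real d * \<theta> > 1"
  shows "\<exists>F. linear_isometric_embedding (T_space k d \<theta>) (T_space (k + 1) d \<theta>) F \<and>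
    (\<forall>x\<in>pts (c00 k d \<theta>).
       F (to_completion (c00 k d \<theta>) x) = to_completion (c00 (k + 1) d \<theta>) (Phi_vec x))"
  unfolding T_space_def using assms
  by (intro linear_isometric_embedding_completion seminormed_space_c00
      linear_isometric_embedding_Phi_vec) auto

end
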